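(* Let $1\le k\le n$, let $\Omega\subset\mathbb{R}^k$ be an open neighborhood of the origin, let $\Phi_1,\dots,\Phi_n:\Omega\to\mathbb{R}$ be smooth, let $\eta:\mathbb{R}^k\to\mathbb{R}$ be smooth and supported in a sufficiently small neighborhood $U\subseteq\Omega$ of the origin, let $\delta_t(x)=(t^{b_1}x_1,\dots,t^{b_n}x_n)$ with $b_j\ge1$ for all $j$, and let $$\mathcal{M}_{\vec\Phi}f(y)=\sup_{t>0}\Big|\int_{\mathbb{R}^k}f\big(y-\delta_t(\Phi_1(x),\dots,\Phi_n(x))\big)\eta(x)\,dx\Big| .$$ Let $\mathcal{L}_n\subset[0,1]^2$ be a convex polygon with non-empty interior and suppose that $\mathcal{M}_{\vec\Phi}$ satisfies the sparse bound: for every $(\frac1p,\frac1{q'})\in\mathcal{L}'_n=\{(\frac1p,\frac1{q'}):(\frac1p,1-\frac1{q'})\in\mathcal L_n\}$ there is $C<\infty$ with $|\langle\mathcal{M}_{\vec\Phi}f,g\rangle|\le C\sup_{\mathcal S}\Lambda_{\mathcal S,p,q'}(f,g)$ for all bounded compactly supported $f,g$, the supremum being over all sparse collections $\mathcal{S}$ of $\delta$-cubes. Then for any $p<r<q<\infty$ with $(\frac1p,\frac1q)\in\mathcal{L}_n$ and any weight $\omega\in A_{r/p}\cap RH_{(q/r)'}$ (defined with respect to $\delta$-cubes), $$\|\mathcal{M}_{\vec\Phi}\|_{L^r(\omega)\to L^r(\omega)}\lesssim\big([\omega]_{A_{r/p}}[\omega]_{RH_{(q/r)'}}\big)^{\alpha},\qquad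 \alpha:=\max\Big(\frac1{r-p},\frac{q-1}{q-r}\Big).$$
   Context: A $\delta$-cube is an axes-parallel hyperrectangle $Q\subset\mathbb{R}^n$ whose side lengths are $l_1(Q)=2^{\lceil mb_1\rceil},\dots,l_n(Q)=2^{\lceil mb_n\rceil}$ for some $m\in\mathbb{Z}$; $\mathcal Q^\delta$ is the collection of all $\delta$-cubes. A collection $\mathcal S$ of $\delta$-cubes is sparse if there are pairwise disjoint sets $E_S\subseteq S$, $S\in\mathcal S$, with $|E_S|>\frac14|S|$. Notation: $\langle f\rangle_{Q,p}=(|Q|^{-1}\int_Q|f|^p)^{1/p}$, $\langle f\rangle_Q=|Q|^{-1}\int_Qf$, $\Lambda_{\mathcal S,p,q'}(f,g)=\sum_{S\in\mathcal S}|S|\langle f\rangle_{S,p}\langle g\rangle_{S,q'}$, $\langle F,g\rangle=\int_{\mathbb{R}^n} Fg$; primes denote conjugate exponents. A weight $\omega$ is a positive (locally integrable) function on $\mathbb{R}^n$; $\|f\|_{L^r(\omega)}=(\int|f|^r\omega)^{1/r}$. For $1<s<\infty$: $\omega\in A_s$ if $[\omega]_{A_s}=\sup_{Q\in\mathcal Q^\delta}\langle\omega\rangle_Q\langle\omega^{1-s'}\rangle_Q^{s-1}<\infty$; $\omega\in RH_s$ if $[\omega]_{RH_s}=\sup_{Q\in\mathcal Q^\delta}\langle\omega\rangle_Q^{-1}\langle\omega\rangle_{Q,s}<\infty$. The operator norm bound is understood as $\|\mathcal{M}_{\vec\Phi}f\|_{L^r(\omega)}\lesssim(\cdots)^\alpha\|f\|_{L^r(\omega)}$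 for all bounded compactly supported $f$, with implied constant independent of $f$ and $\omega$. *)

theory Defs
  imports "HOL-Analysis.Analysis" "HOL-Probability.Essential_Supremum"
begin

section \<open>Smooth functions\<close>

text \<open>Intended for open \<open>S\<close>.\<close>

primrec Ck_on :: "nat \<Rightarrow> 'a::real_normed_vector set \<Rightarrow> ('a \<Rightarrow> 'b::real_normed_vector) \<Rightarrow> bool" where
  "Ck_on 0 S f \<longleftrightarrow> continuous_on S f"
| "Ck_on (Suc m) S f \<longleftrightarrow>
     (\<forall>x\<in>S. f differentiable (at x)) \<and> (\<forall>v. Ck_on m S (\<lambda>x. frechet_derivative f (at x) v))"

definition smooth_on :: "'a::real_normed_vector set \<Rightarrow> ('a \<Rightarrow> 'b::real_normed_vector) \<Rightarrow> bool" where
  "smooth_on S f \<longleftrightarrow> (\<forall>m. Ck_on m S f)"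


section \<open>The maximal operator\<close>

definition dilation :: "('n \<Rightarrow> real) \<Rightarrow> real \<Rightarrow> real ^ 'n \<Rightarrow> real ^ 'n" where
  "dilation b t x = (\<chi> j. t powr b j * x $ j)"

text \<open>
  The maps \<open>\<Phi> j\<close> are only meaningful on \<open>\<Omega>\<close>; values outside \<open>\<Omega>\<close> are irrelevant because \<open>\<eta>\<close>
  is supported inside \<open>\<Omega>\<close>.
  The supremum is one of real numbers; for bounded \<open>f\<close> and integrable \<open>\<eta>\<close> the set is bounded.
\<close>

definition max_op ::
  "('n::finite \<Rightarrow> real) \<Rightarrow> ('n \<Rightarrow> real ^ 'k::finite \<Rightarrow> real) \<Rightarrow> (real ^ 'k \<Rightarrow> real)
    \<Rightarrow> (real ^ 'n \<Rightarrow> complex) \<Rightarrow> real ^ 'n \<Rightarrow> real" where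
  "max_op b \<Phi> \<eta> f y =
     (SUP t\<in>{0<..}. norm (LINT x|lborel. f (y - dilation b t (\<chi> j. \<Phi> j x)) * complex_of_real (\<eta> x)))"

text \<open>
  Bounded compactly supported functions. They are Borel functions defined everywhere, not classes
  modulo null sets, since the maximal operator samples \<open>f\<close> on possibly lower-dimensional sets.
\<close>

definition bounded_cpt_supp :: "(real ^ 'n::finite \<Rightarrow> complex) \<Rightarrow> bool" where
  "bounded_cpt_supp f \<longleftrightarrow>
     f \<in> borel_measurable borel \<and> bounded (range f) \<and> compact (closure {x. f x \<noteq> 0})"


section \<open>Cubes and averages\<close>

definition delta_cubes :: "('n::finite \<Rightarrow> real) \<Rightarrow> (real ^ 'n) set set" where
  "delta_cubes b =
     {cbox a c | a c. \<exists>m::int. \<forall>j. c $ j - a $ j = 2 powi \<lceil>of_int m * b j\<rceil>}"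

definition sparse :: "('n::finite \<Rightarrow> real) \<Rightarrow> (real ^ 'n) set set \<Rightarrow> bool" where
  "sparse b \<S> \<longleftrightarrow> \<S> \<subseteq> delta_cubes b \<and>
     (\<exists>E. disjoint_family_on E \<S> \<and>
        (\<forall>S\<in>\<S>. E S \<in> sets lebesgue \<and> E S \<subseteq> S \<and> measure lebesgue (E S) > 1/4 * measure lebesgue S))"

text \<open>Powers on \<open>[0,\<infinity>]\<close>, used only for exponents \<open>a > 0\<close>.\<close>

definition epowr :: "ennreal \<Rightarrow> real \<Rightarrow> ennreal" where
  "epowr x a = (if x = top then top else ennreal (enn2real x powr a))"

definition avg :: "(real ^ 'n::finite \<Rightarrow> real) \<Rightarrow> (real ^ 'n) set \<Rightarrow> ennreal" where
  "avg h Q = (\<integral>\<^sup>+ x\<in>Q. ennreal (h x) \<partial>lebesgue) / emeasure lebesgue Q"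

text \<open>The \<open>p\<close>-average for \<open>p\<close> in \<open>[1,\<infinity>]\<close>, with the essential supremum for \<open>p = \<infinity>\<close>.\<close>

definition p_avg ::
  "ennreal \<Rightarrow> (real ^ 'n::finite \<Rightarrow> 'a::real_normed_vector) \<Rightarrow> (real ^ 'n) set \<Rightarrow> ennreal" where
  "p_avg p f Q =
     (if p = top then esssup (restrict_space lebesgue Q) (\<lambda>x. ennreal (norm (f x)))
      else epowr (avg (\<lambda>x. norm (f x) powr enn2real p) Q) (1 / enn2real p))"

definition sparse_form ::
  "(real ^ 'n::finite) set set \<Rightarrow> ennreal \<Rightarrow> ennreal
    \<Rightarrow> (real ^ 'n \<Rightarrow> complex) \<Rightarrow> (real ^ 'n \<Rightarrow> complex) \<Rightarrow> ennreal" where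
  "sparse_form \<S> p s f g = (\<Sum>\<^sub>\<infinity>S\<in>\<S>. emeasure lebesgue S * p_avg p f S * p_avg s g S)"

text \<open>
  The \<open>(p,s)\<close> sparse bound for an operator \<open>T\<close>; \<open>s\<close> plays the role of \<open>q'\<close>.
  Integrability is stated explicitly because the Bochner integral of a non-integrable function is
  \<open>0\<close>; it expresses that the pairing \<open>\<langle>T f, g\<rangle>\<close> exists.
\<close>

definition sparse_bound ::
  "('n::finite \<Rightarrow> real) \<Rightarrow> ((real ^ 'n \<Rightarrow> complex) \<Rightarrow> real ^ 'n \<Rightarrow> real) \<Rightarrow> ennreal \<Rightarrow> ennreal \<Rightarrow> bool" where
  "sparse_bound b T p s \<longleftrightarrow>
     (\<exists>C::real. \<forall>f g. bounded_cpt_supp f \<longrightarrow> bounded_cpt_supp g \<longrightarrow>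
        integrable lebesgue (\<lambda>x. complex_of_real (T f x) * g x) \<and>
        ennreal (norm (LINT x|lebesgue. complex_of_real (T f x) * g x))
          \<le> ennreal C * (SUP \<S>\<in>{\<S>. sparse b \<S>}. sparse_form \<S> p s f g))"

definition dual_region :: "(real \<times> real) set \<Rightarrow> (real \<times> real) set" where
  "dual_region L = {(u, v). (u, 1 - v) \<in> L}"


section \<open>Weights\<close>

definition conj_exp :: "real \<Rightarrow> real" where
  "conj_exp s = s / (s - 1)"

definition weight :: "(real ^ 'n::finite \<Rightarrow> real) \<Rightarrow> bool" where
  "weight \<omega> \<longleftrightarrow> \<omega> \<in> borel_measurable lebesgue \<and> (\<forall>x. 0 < \<omega> x) \<and>
     (\<forall>K. compact K \<longrightarrow> set_integrable lebesgue K \<omega>)"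

definition A_const :: "('n::finite \<Rightarrow> real) \<Rightarrow> real \<Rightarrow> (real ^ 'n \<Rightarrow> real) \<Rightarrow> ennreal" where
  "A_const b s \<omega> =
     (SUP Q\<in>delta_cubes b. avg \<omega> Q * epowr (avg (\<lambda>x. \<omega> x powr (1 - conj_exp s)) Q) (s - 1))"

definition RH_const :: "('n::finite \<Rightarrow> real) \<Rightarrow> real \<Rightarrow> (real ^ 'n \<Rightarrow> real) \<Rightarrow> ennreal" where
  "RH_const b s \<omega> = (SUP Q\<in>delta_cubes b. inverse (avg \<omega> Q) * p_avg (ennreal s) \<omega> Q)"

definition A_class :: "('n::finite \<Rightarrow> real) \<Rightarrow> real \<Rightarrow> (real ^ 'n \<Rightarrow> real) set" where
  "A_class b s = {\<omega>. weight \<omega> \<and> A_const b s \<omega> < top}"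

definition RH_class :: "('n::finite \<Rightarrow> real) \<Rightarrow> real \<Rightarrow> (real ^ 'n \<Rightarrow> real) set" where
  "RH_class b s = {\<omega>. weight \<omega> \<and> RH_const b s \<omega> < top}"

definition wnorm ::
  "real \<Rightarrow> (real ^ 'n::finite \<Rightarrow> real) \<Rightarrow> (real ^ 'n \<Rightarrow> 'a::real_normed_vector) \<Rightarrow> ennreal" where
  "wnorm r \<omega> f = epowr (\<integral>\<^sup>+ x. ennreal (norm (f x) powr r * \<omega> x) \<partial>lebesgue) (1 / r)"

end

theory Submission
  imports Defs
begin

text \<open>
  Put \<open>\<sigma> = \<omega>\<^bsup>-p/(r-p)\<^esup>\<close> and \<open>\<tau> = \<omega>\<^bsup>q/(q-r)\<^esup>\<close>. On a \<open>\<delta>\<close>-cube the product of the two weight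
  constants controls \<open>\<langle>\<sigma>\<rangle>\<^bsup>(r-p)/p\<^esup> \<langle>\<tau>\<rangle>\<^bsup>(q-r)/q\<^esup>\<close>, because the averages of \<open>\<omega>\<close> cancel, while
  Hoelder's inequality bounds the same expression from below on the large subset \<open>E\<^sub>S\<close>. Together
  they allow one to replace, at the cost of the power \<open>\<alpha>\<close>, the factors \<open>\<langle>\<sigma>\<rangle>\<^bsup>1/p\<^esup> \<langle>\<tau>\<rangle>\<^bsup>1/q'\<^esup>\<close>
  by \<open>\<sigma>(E\<^sub>S)\<^bsup>1/r\<^esup> \<tau>(E\<^sub>S)\<^bsup>1/r'\<^esup> / |S|\<close>. Hoelder's inequality over \<open>S\<close> and the maximal theorem for the
  measures \<open>\<sigma>\<close> and \<open>\<tau>\<close> then bound the sparse form. For constants independent of the weight the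
  maximal theorem needs nested cubes, so each cube of the sparse family is first enlarged to a cell
  of one of finitely many shifted dyadic grids. The operator bound follows by testing against
  truncations of \<open>|T f|\<^bsup>r-1\<^esup> sgn(T f) \<omega>\<close>; of the maximal operator only its sparse bound is used.
\<close>

section \<open>Maximal inequality for laminar families\<close>

text \<open>The exponents of \<sigma> and \<tau> are forced. Pointwise \<sigma>^((r-p)/p)
  \<tau>^((q-r)/q) = 1, so Hoelder bounds the measure of E_S by its two weighted masses without any
  weight constant. Moreover (|f|^p)^(r/p) \<sigma>^(1-r/p) = |f|^r \<omega> and (|g|^q')^(r'/q')
  \<tau>^(1-r'/q') = |g|^r' \<omega>^(-1/(r-1)). Hence the maximal theorem for \<sigma> in L^(r/p),
  applied to |f|^p / \<sigma>, returns exactly the norm of f in L^r(\<omega>), and the one for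
  \<tau> returns the dual norm of g. The enlargement of the cubes has to meet two further demands:
  E_S must remain a fixed proportion of the larger set, and the weight constants, which are suprema
  over closed cubes, must still apply to it. Grid cells meet both: up to null sets they are
  themselves \<delta>-cubes, and their volume exceeds that of S by at most a factor that depends on
  \<open>b\<close> alone.\<close>

definition laminar :: "'a set set \<Rightarrow> bool" where
  "laminar \<D> \<longleftrightarrow> (\<forall>A\<in>\<D>. \<forall>B\<in>\<D>. A \<subseteq> B \<or> B \<subseteq> A \<or> A \<inter> B = {})"

lemma laminar_subset: "laminar \<D> \<Longrightarrow> \<C> \<subseteq> \<D> \<Longrightarrow> laminar \<C>"
  unfolding laminar_def by blast

text \<open>The maximal members are pairwise disjoint and cover the union, so the inequality adds up
  over them with no overlap constant. This takes the place of a covering lemma and asks for no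
  doubling property of \<open>M\<close>.\<close>

lemma laminar_Union_emeasure_le:
  fixes c :: ennreal
  assumes "finite \<D>" "laminar \<D>" "\<D> \<subseteq> sets M" "sets N = sets M"
    and le: "\<And>A. A \<in> \<D> \<Longrightarrow> c * emeasure M A \<le> emeasure N A"
  shows "c * emeasure M (\<Union>\<D>) \<le> emeasure N (\<Union>\<D>)"
proof -
  define \<C> where "\<C> = {A\<in>\<D>. \<forall>B\<in>\<D>. A \<subseteq> B \<longrightarrow> B = A}"
  have fin: "finite \<C>" using assms(1) by (simp add: \<C>_def)
  have sub: "\<C> \<subseteq> \<D>" by (auto simp: \<C>_def)
  have "\<Union>\<D> \<subseteq> \<Union>\<C>"
  proof
    fix x assume "x \<in> \<Union>\<D>"
    then obtain A where A: "A \<in> \<D>" "x \<in> A" by blast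
    obtain B where B: "B \<in> \<D>" "A \<subseteq> B" "\<And>C. C \<in> \<D> \<Longrightarrow> B \<subseteq> C \<Longrightarrow> C = B"
      using finite_has_maximal2[OF assms(1) A(1)] by metis
    then have "B \<in> \<C>" by (auto simp: \<C>_def)
    then show "x \<in> \<Union>\<C>" using A B by blast
  qed
  then have eq: "\<Union>\<D> = \<Union>\<C>" using sub by blast
  have disj: "disjoint_family_on (\<lambda>A. A) \<C>"
  proof (unfold disjoint_family_on_def, intro ballI impI)
    fix A B assume "A \<in> \<C>" "B \<in> \<C>" "A \<noteq> B"
    then have "A \<in> \<D>" "B \<in> \<D>" "\<not> A \<subseteq> B" "\<not> B \<subseteq> A"
      by (auto simp: \<C>_def)
    then show "A \<inter> B = {}" using assms(2) unfolding laminar_def by metis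
  qed
  have UM: "emeasure M (\<Union>\<C>) = (\<Sum>A\<in>\<C>. emeasure M A)"
    using sum_emeasure[of "\<lambda>A. A" \<C> M] disj fin sub assms(3) by auto
  have UN: "emeasure N (\<Union>\<C>) = (\<Sum>A\<in>\<C>. emeasure N A)"
    using sum_emeasure[of "\<lambda>A. A" \<C> N] disj fin sub assms(3,4) by auto
  show ?thesis
    unfolding eq UM UN sum_distrib_left using le sub by (intro sum_mono) auto
qed

text \<open>The disjoint sets \<open>E i\<close> turn the sum into the measure of one subset of the
  union of the selected cubes, and the union lemma applies with the part of \<open>u\<close> above
  \<open>l/2\<close> as density of the second measure. The family is indexed because several sparse
  cubes may be enlarged to the same cell: \<open>Q\<close> need not be injective, only the
  \<open>E i\<close> are disjoint.\<close>

lemma laminar_weak_type: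
  fixes u :: "'a \<Rightarrow> real" and A :: "'i \<Rightarrow> real" and l :: real
  assumes "finite I" "laminar (Q ` I)" and Q: "\<And>i. i \<in> I \<Longrightarrow> Q i \<in> sets M"
    and Qfin: "\<And>i. i \<in> I \<Longrightarrow> emeasure M (Q i) < \<infinity>"
    and E: "\<And>i. i \<in> I \<Longrightarrow> E i \<in> sets M" "\<And>i. i \<in> I \<Longrightarrow> E i \<subseteq> Q i" "disjoint_family_on E I"
    and u[measurable]: "u \<in> borel_measurable M" and u0: "\<And>x. 0 \<le> u x"
    and avg: "\<And>i. i \<in> I \<Longrightarrow> ennreal (A i) * emeasure M (Q i) \<le> (\<integral>\<^sup>+x\<in>Q i. ennreal (u x) \<partial>M)"
    and l: "0 < l"
  shows "ennreal (l / 2) * (\<Sum>i | i \<in> I \<and> l < A i. emeasure M (E i))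
    \<le> (\<integral>\<^sup>+x. ennreal (u x) * indicator {l/2<..} (u x) \<partial>M)"
proof -
  define J where "J = {i \<in> I. l < A i}"
  define N where "N = density M (\<lambda>x. ennreal (u x) * indicator {l/2<..} (u x))"
  have J: "finite J" "J \<subseteq> I" using assms(1) by (auto simp: J_def)
  have setsN: "sets N = sets M" by (simp add: N_def)
  \<comment> \<open>The part of \<open>u\<close> below \<open>l/2\<close> contributes at most half of the average, so it can be absorbed.\<close>
  have one: "ennreal (l/2) * emeasure M (Q i) \<le> emeasure N (Q i)" if "i \<in> J" for i
  proof -
    have i: "i \<in> I" "l < A i" using that by (auto simp: J_def)
    note [measurable] = Q[OF i(1)]
    have "ennreal l = ennreal (l/2) + ennreal (l/2)"
      using l by (subst ennreal_plus[symmetric]) auto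
    then    have "ennreal (l/2) * emeasure M (Q i) + ennreal (l/2) * emeasure M (Q i)
        = ennreal l * emeasure M (Q i)"
      by (simp only: distrib_right)
    also have "\<dots> \<le> ennreal (A i) * emeasure M (Q i)"
      using i l by (intro mult_right_mono ennreal_leI) auto
    also have "\<dots> \<le> (\<integral>\<^sup>+x\<in>Q i. ennreal (u x) \<partial>M)" by (rule avg[OF i(1)])
    also have "\<dots> \<le> (\<integral>\<^sup>+x. (ennreal (u x) * indicator {l/2<..} (u x)) * indicator (Q i) x
          + ennreal (l/2) * indicator (Q i) x \<partial>M)"
      using u0 l by (intro nn_integral_mono) (auto split: split_indicator intro!: ennreal_leI)
    also have "\<dots> = emeasure N (Q i) + ennreal (l/2) * emeasure M (Q i)"
      by (subst nn_integral_add) (auto simp: N_def emeasure_density nn_integral_cmult_indicator)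
    finally have "ennreal (l/2) * emeasure M (Q i) + ennreal (l/2) * emeasure M (Q i)
        \<le> ennreal (l/2) * emeasure M (Q i) + emeasure N (Q i)"
      by (simp only: add.commute)
    moreover have "ennreal (l/2) * emeasure M (Q i) \<noteq> \<infinity>"
      using Qfin[OF i(1)] by (simp add: ennreal_mult_eq_top_iff)
    ultimately show ?thesis by (simp only: ennreal_add_left_cancel_le) simp
  qed
  have meas: "(\<Union>i\<in>J. Q i) \<in> sets M" using J Q by auto
  have "(\<Sum>i | i \<in> I \<and> l < A i. emeasure M (E i)) = emeasure M (\<Union>i\<in>J. E i)"
    unfolding J_def[symmetric] using J E 
    by (intro sum_emeasure) (auto simp: disjoint_family_on_def subset_iff)
  also have "\<dots> \<le> emeasure M (\<Union>i\<in>J. Q i)"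
    using J E meas by (intro emeasure_mono) blast+
  finally have "ennreal (l/2) * (\<Sum>i | i \<in> I \<and> l < A i. emeasure M (E i)) 
      \<le> ennreal (l/2) * emeasure M (\<Union>(Q ` J))"
    by (intro mult_left_mono) auto
  also have "\<dots> \<le> emeasure N (\<Union>(Q ` J))"
    using J Q one setsN laminar_subset[OF assms(2), of "Q ` J"]
    by (intro laminar_Union_emeasure_le) auto
  also have "\<dots> \<le> emeasure N (space N)" by (rule emeasure_space)
  also have "\<dots> = (\<integral>\<^sup>+x. ennreal (u x) * indicator {l/2<..} (u x) \<partial>M)"
    unfolding N_def by (subst emeasure_density) (auto intro!: nn_integral_cong)
  finally show ?thesis .
qed

text \<open>A layer-cake bound that keeps only the levels between \<open>a/2\<close> and
  \<open>a\<close>, where the integrand is at least \<open>(a/2) powr (s - 1)\<close>. The constant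
  lost in this way is harmless.\<close>

lemma powr_le_nn_integral:
  fixes a s :: real
  assumes "0 \<le> a" "1 < s"
  shows "ennreal (a powr s) \<le> ennreal (2 powr s) * 
     (\<integral>\<^sup>+l. ennreal (l powr (s - 1)) * indicator {0<..<a} l \<partial>lborel)"
proof -
  have "a powr s = 2 powr s * ((a/2) powr (s - 1) * (a/2))"
  proof (cases "a = 0")
    case False
    then have "(a/2) powr (s - 1) * (a/2) = (a/2) powr s"
      using assms by (simp add: powr_diff)
    then show ?thesis using assms by (simp flip: powr_mult)
  qed (use assms in simp)
  then have "ennreal (a powr s) = ennreal (2 powr s * ((a/2) powr (s - 1) * (a/2)))"
    by (rule arg_cong)
  also have "\<dots> = ennreal (2 powr s) * (ennreal ((a/2) powr (s - 1)) * ennreal (a/2))"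
    by (subst ennreal_mult', simp, subst ennreal_mult', simp, rule refl)
  finally have eq: "ennreal (a powr s) = ennreal (2 powr s) * (ennreal ((a/2) powr (s - 1)) * ennreal (a/2))" .
  have "ennreal ((a/2) powr (s - 1)) * ennreal (a/2) 
     = (\<integral>\<^sup>+l. ennreal ((a/2) powr (s - 1)) * indicator {a/2<..<a} l \<partial>lborel)"
    using assms by (subst nn_integral_cmult_indicator) auto
  also have "\<dots> \<le> (\<integral>\<^sup>+l. ennreal (l powr (s - 1)) * indicator {0<..<a} l \<partial>lborel)"
  proof (intro nn_integral_mono)
    fix l :: real
    show "ennreal ((a/2) powr (s - 1)) * indicator {a/2<..<a} l \<le> ennreal (l powr (s - 1)) * indicator {0<..<a} l"
    proof (cases "l \<in> {a/2<..<a}")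
      case True
      then have "(a/2) powr (s - 1) \<le> l powr (s - 1)"
        using assms by (intro powr_mono2) auto
      then show ?thesis using True assms by (simp add: ennreal_leI)
    qed simp
  qed
  finally show ?thesis unfolding eq by (rule mult_left_mono) simp
qed

lemma nn_integral_powr_0:
  fixes c a :: real
  assumes "0 \<le> c" "- 1 < a"
  shows "(\<integral>\<^sup>+l. ennreal (l powr a) * indicator {0<..<c} l \<partial>lborel) \<le> ennreal (c powr (a + 1) / (a + 1))"
proof -
  have "(\<integral>\<^sup>+l. ennreal (l powr a) * indicator {0<..<c} l \<partial>lborel)
     \<le> (\<integral>\<^sup>+l. ennreal (indicator {0..c} l * l powr a) \<partial>lborel)"
    by (intro nn_integral_mono) (auto split: split_indicator)
  also have "\<dots> = ennreal (c powr (a + 1) / (a + 1))"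
    using nn_integral_has_integral_lebesgue[OF _ has_integral_powr_from_0[OF assms(2,1)]] by simp
  finally show ?thesis .
qed

text \<open>
  The usual consequence of the maximal theorem. Truncating \<open>u\<close> at height \<open>l/2\<close> as in Marcinkiewicz
  interpolation avoids having to know beforehand that the left-hand side is finite.
\<close>

lemma laminar_Carleson:
  fixes u :: "'a \<Rightarrow> real" and A :: "'i \<Rightarrow> real" and s :: real
  assumes "sigma_finite_measure M"
    and "finite I" "laminar (Q ` I)" and Q: "\<And>i. i \<in> I \<Longrightarrow> Q i \<in> sets M"
    and Qfin: "\<And>i. i \<in> I \<Longrightarrow> emeasure M (Q i) < \<infinity>"
    and E: "\<And>i. i \<in> I \<Longrightarrow> E i \<in> sets M" "\<And>i. i \<in> I \<Longrightarrow> E i \<subseteq> Q i" "disjoint_family_on E I"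
    and u[measurable]: "u \<in> borel_measurable M" and u0: "\<And>x. 0 \<le> u x"
    and A0: "\<And>i. i \<in> I \<Longrightarrow> 0 \<le> A i"
    and avg: "\<And>i. i \<in> I \<Longrightarrow> ennreal (A i) * emeasure M (Q i) \<le> (\<integral>\<^sup>+x\<in>Q i. ennreal (u x) \<partial>M)"
    and s: "1 < s"
  shows "(\<Sum>i\<in>I. ennreal (A i powr s) * emeasure M (E i))
     \<le> ennreal (4 powr s / (s - 1)) * (\<integral>\<^sup>+x. ennreal (u x powr s) \<partial>M)"
proof -
  interpret sigma_finite_measure M by fact
  interpret P: pair_sigma_finite M lborel by (simp add: lborel.sigma_finite_measure_axioms pair_sigma_finite_def sigma_finite_measure_axioms)
  have "(\<Sum>i\<in>I. ennreal (A i powr s) * emeasure M (E i))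
    \<le> (\<Sum>i\<in>I. ennreal (2 powr s) * 
     (\<integral>\<^sup>+l. ennreal (l powr (s - 1)) * indicator {0<..<A i} l \<partial>lborel) * emeasure M (E i))"
    using A0 s by (intro sum_mono mult_right_mono powr_le_nn_integral) auto
  also have "\<dots> = ennreal (2 powr s) * (\<integral>\<^sup>+l. (\<Sum>i\<in>I. ennreal (l powr (s - 1)) 
      * indicator {0<..<A i} l * emeasure M (E i)) \<partial>lborel)"
  proof (subst nn_integral_sum)
    show "(\<Sum>i\<in>I. ennreal (2 powr s) * (\<integral>\<^sup>+l. ennreal (l powr (s - 1)) * indicator {0<..<A i} l \<partial>lborel)
        * emeasure M (E i))
      = ennreal (2 powr s) * (\<Sum>i\<in>I. \<integral>\<^sup>+l. ennreal (l powr (s - 1)) * indicator {0<..<A i} l 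
        * emeasure M (E i) \<partial>lborel)"
      unfolding sum_distrib_left mult.assoc[of "ennreal (2 powr s)"]
      by (intro sum.cong refl arg_cong[where f="\<lambda>x. ennreal (2 powr s) * x"] nn_integral_multc[symmetric]) measurable
  qed measurable
  \<comment> \<open>One factor \<open>l/2\<close> of \<open>l powr (s - 1)\<close> is spent on the
    weak-type estimate; \<open>2 * l powr (s - 2)\<close> remains.\<close>
  also have "\<dots> \<le> ennreal (2 powr s) * (\<integral>\<^sup>+l. (\<integral>\<^sup>+x. ennreal (2 * l powr (s - 2)) * indicator {0<..} l 
      * (ennreal (u x) * indicator {l/2<..} (u x)) \<partial>M) \<partial>lborel)"
  proof (intro mult_left_mono nn_integral_mono)
    fix l :: real
    show "(\<Sum>i\<in>I. ennreal (l powr (s - 1)) * indicator {0<..<A i} l * emeasure M (E i))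
      \<le> (\<integral>\<^sup>+x. ennreal (2 * l powr (s - 2)) * indicator {0<..} l 
         * (ennreal (u x) * indicator {l/2<..} (u x)) \<partial>M)"
    proof (cases "0 < l")
      case True
      have eq: "ennreal (l powr (s - 1)) = ennreal (2 * l powr (s - 2)) * ennreal (l / 2)"
      proof -
        have "l powr (s - 1) = l powr (s - 2) * l"
          using True powr_add[of l "s - 2" 1] by simp
        then show ?thesis using True by (simp flip: ennreal_mult)
      qed
      have "(\<Sum>i\<in>I. ennreal (l powr (s - 1)) * indicator {0<..<A i} l * emeasure M (E i))
        = (\<Sum>i | i \<in> I \<and> l < A i. ennreal (l powr (s - 1)) * emeasure M (E i))"
        using assms(2) True by (intro sum.mono_neutral_cong_right) (auto split: split_indicator)
      also have "\<dots> = ennreal (2 * l powr (s - 2)) * (ennreal (l / 2) * (\<Sum>i | i \<in> I \<and> l < A i. emeasure M (E i)))"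
        unfolding eq sum_distrib_left by (simp add: mult.assoc)
      also have "\<dots> \<le> ennreal (2 * l powr (s - 2)) * (\<integral>\<^sup>+x. ennreal (u x) * indicator {l/2<..} (u x) \<partial>M)"
        using assms True by (intro mult_left_mono laminar_weak_type[where Q=Q]) auto
      also have "\<dots> = (\<integral>\<^sup>+x. ennreal (2 * l powr (s - 2)) * indicator {0<..} l 
         * (ennreal (u x) * indicator {l/2<..} (u x)) \<partial>M)"
        using True by (subst nn_integral_cmult) auto
      finally show ?thesis .
    qed (auto simp: indicator_def)
  qed auto
  finally have *: "(\<Sum>i\<in>I. ennreal (A i powr s) * emeasure M (E i))
    \<le> ennreal (2 powr s) * (\<integral>\<^sup>+l. (\<integral>\<^sup>+x. ennreal (2 * l powr (s - 2)) * indicator {0<..} l 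
      * (ennreal (u x) * indicator {l/2<..} (u x)) \<partial>M) \<partial>lborel)" .
  \<comment> \<open>After the interchange the levels stop at \<open>2 * u x\<close>, since
    \<open>u x\<close> counts only while it exceeds \<open>l/2\<close>. The remaining power is
    integrable at 0 because \<open>s - 2 > -1\<close>.\<close>
  have "(\<integral>\<^sup>+l. (\<integral>\<^sup>+x. ennreal (2 * l powr (s - 2)) * indicator {0<..} l 
      * (ennreal (u x) * indicator {l/2<..} (u x)) \<partial>M) \<partial>lborel)
    = (\<integral>\<^sup>+x. (\<integral>\<^sup>+l. ennreal (2 * l powr (s - 2)) * indicator {0<..} l 
      * (ennreal (u x) * indicator {l/2<..} (u x)) \<partial>lborel) \<partial>M)"
    by (rule P.Fubini') (simp add: greaterThan_def, measurable)
  also have "\<dots> \<le> (\<integral>\<^sup>+x. ennreal (2 powr s / (s - 1)) * ennreal (u x powr s) \<partial>M)"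
  proof (intro nn_integral_mono)
    fix x
    have "(\<integral>\<^sup>+l. ennreal (2 * l powr (s - 2)) * indicator {0<..} l 
          * (ennreal (u x) * indicator {l/2<..} (u x)) \<partial>lborel)
       = (\<integral>\<^sup>+l. ennreal (2 * u x) * (ennreal (l powr (s - 2)) * indicator {0<..<2 * u x} l) \<partial>lborel)"
      using u0[of x] by (intro nn_integral_cong) (auto split: split_indicator simp: ennreal_mult mult_ac)
    also have "\<dots> = ennreal (2 * u x) * (\<integral>\<^sup>+l. ennreal (l powr (s - 2)) * indicator {0<..<2 * u x} l \<partial>lborel)"
      by (subst nn_integral_cmult) auto
    also have "\<dots> \<le> ennreal (2 * u x) * ennreal ((2 * u x) powr (s - 2 + 1) / (s - 2 + 1))"
      using u0[of x] s by (intro mult_left_mono nn_integral_powr_0) auto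
    also have "\<dots> = ennreal ((2 * u x) * ((2 * u x) powr (s - 1) / (s - 1)))"
      using u0[of x] s by (subst ennreal_mult) auto
    also have "(2 * u x) * ((2 * u x) powr (s - 1) / (s - 1)) = 2 powr s / (s - 1) * u x powr s"
    proof (cases "u x = 0")
      case False
      then have "(2 * u x) * (2 * u x) powr (s - 1) = (2 * u x) powr s"
        using u0[of x] by (simp add: powr_diff)
      then show ?thesis using u0[of x] by (simp add: powr_mult)
    qed (use s in simp)
    also have "ennreal (2 powr s / (s - 1) * u x powr s) = ennreal (2 powr s / (s - 1)) * ennreal (u x powr s)"
      using s by (intro ennreal_mult) auto
    finally show "(\<integral>\<^sup>+l. ennreal (2 * l powr (s - 2)) * indicator {0<..} l 
          * (ennreal (u x) * indicator {l/2<..} (u x)) \<partial>lborel)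
       \<le> ennreal (2 powr s / (s - 1)) * ennreal (u x powr s)" .
  qed
  also have "\<dots> = ennreal (2 powr s / (s - 1)) * (\<integral>\<^sup>+x. ennreal (u x powr s) \<partial>M)"
    by (rule nn_integral_cmult) simp
  finally have "(\<Sum>i\<in>I. ennreal (A i powr s) * emeasure M (E i))
    \<le> ennreal (2 powr s) * (ennreal (2 powr s / (s - 1)) * (\<integral>\<^sup>+x. ennreal (u x powr s) \<partial>M))"
    by (intro order_trans[OF *] mult_left_mono) auto
  \<comment> \<open>One \<open>2 powr s\<close> comes from the layer cake, the other from the upper
    limit \<open>2 * u x\<close>.\<close>
  also have "\<dots> = ennreal (4 powr s / (s - 1)) * (\<integral>\<^sup>+x. ennreal (u x powr s) \<partial>M)"
    using s by (subst mult.assoc[symmetric], subst ennreal_mult[symmetric]) (auto simp flip: powr_mult)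
  finally show ?thesis .
qed

section \<open>Sparse sums over a laminar family\<close>

text \<open>Young's inequality for the normalised functions \<open>F / a\<close> and
  \<open>G / b\<close>, integrated. Normalising divides by \<open>a\<close> and \<open>b\<close>, so
  the case where one of them vanishes, and the product is zero almost everywhere, is treated
  separately.\<close>

lemma nn_integral_Holder:
  fixes F G :: "'a \<Rightarrow> real" and a b t :: real
  assumes [measurable]: "F \<in> borel_measurable M" "G \<in> borel_measurable M"
    and F0: "\<And>x. 0 \<le> F x" and G0: "\<And>x. 0 \<le> G x" and ab: "0 \<le> a" "0 \<le> b"
    and t: "0 < t" "t < 1"
    and F: "(\<integral>\<^sup>+x. ennreal (F x) \<partial>M) = ennreal a" and G: "(\<integral>\<^sup>+x. ennreal (G x) \<partial>M) = ennreal b"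
  shows "(\<integral>\<^sup>+x. ennreal (F x powr t * G x powr (1 - t)) \<partial>M) \<le> ennreal (a powr t * b powr (1 - t))"
proof (cases "a = 0 \<or> b = 0")
  case True
  then have "(AE x in M. F x = 0) \<or> (AE x in M. G x = 0)"
    using F G F0 G0 by (auto simp: nn_integral_0_iff_AE ennreal_eq_0_iff antisym intro: AE_mp)
  then have "AE x in M. ennreal (F x powr t * G x powr (1 - t)) = 0"
    by auto
  then have "(\<integral>\<^sup>+x. ennreal (F x powr t * G x powr (1 - t)) \<partial>M) = 0"
    by (subst nn_integral_0_iff_AE) auto
  then show ?thesis by simp
next
  case False
  then have a: "0 < a" and b: "0 < b" using ab by auto
  define K where "K = a powr t * b powr (1 - t)"
  have K: "0 \<le> K" by (simp add: K_def)
  have pt: "F x powr t * G x powr (1 - t) \<le> (K * t / a) * F x + (K * (1 - t) / b) * G x" for x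
  proof (cases "F x = 0 \<or> G x = 0")
    case True
    then have "F x powr t * G x powr (1 - t) = 0" by auto
    also have "0 \<le> (K * t / a) * F x + (K * (1 - t) / b) * G x"
      using F0 G0 a b t K by (intro add_nonneg_nonneg mult_nonneg_nonneg) auto
    finally show ?thesis .
  next
    case False
    then have "0 < F x / a" "0 < G x / b" using F0[of x] G0[of x] a b by (auto simp: less_le)
    then have "(F x / a) powr t * (G x / b) powr (1 - t) \<le> t * (F x / a) + (1 - t) * (G x / b)"
      using t by (intro Youngs_inequality_0) auto
    then have "K * ((F x / a) powr t * (G x / b) powr (1 - t)) \<le> K * (t * (F x / a) + (1 - t) * (G x / b))"
      using K by (rule mult_left_mono)
    moreover have "K * ((F x / a) powr t * (G x / b) powr (1 - t)) = F x powr t * G x powr (1 - t)"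
      using a b F0 G0 by (simp add: K_def powr_divide)
    ultimately show ?thesis by (simp add: algebra_simps)
  qed
  have "(\<integral>\<^sup>+x. ennreal (F x powr t * G x powr (1 - t)) \<partial>M)
     \<le> (\<integral>\<^sup>+x. ennreal (K * t / a) * ennreal (F x) + ennreal (K * (1 - t) / b) * ennreal (G x) \<partial>M)"
  proof (rule nn_integral_mono)
    fix x
    have "ennreal (F x powr t * G x powr (1 - t)) \<le> ennreal ((K * t / a) * F x + (K * (1 - t) / b) * G x)"
      by (rule ennreal_leI[OF pt])
    also have "\<dots> = ennreal (K * t / a) * ennreal (F x) + ennreal (K * (1 - t) / b) * ennreal (G x)"
      using a b t K F0 G0 by (subst ennreal_plus) (auto simp: ennreal_mult' simp del: times_divide_eq_left)
    finally show "ennreal (F x powr t * G x powr (1 - t)) 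
      \<le> ennreal (K * t / a) * ennreal (F x) + ennreal (K * (1 - t) / b) * ennreal (G x)" .
  qed
  also have "\<dots> = ennreal (K * t / a) * ennreal a + ennreal (K * (1 - t) / b) * ennreal b"
    by (subst nn_integral_add; (subst nn_integral_cmult)?; (subst nn_integral_cmult)?) (auto simp: F G)
  also have "\<dots> = ennreal K"
  proof -
    have "ennreal (K * t / a) * ennreal a = ennreal (K * t)" "ennreal (K * (1 - t) / b) * ennreal b = ennreal (K * (1 - t))"
      using a b t K by (auto simp flip: ennreal_mult)
    moreover have "ennreal (K * t) + ennreal (K * (1 - t)) = ennreal (K * t + K * (1 - t))"
      using t K by (intro ennreal_plus[symmetric]) auto
    ultimately show ?thesis by (simp add: algebra_simps)
  qed
  finally show ?thesis by (simp add: K_def)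
qed

lemma sum_Holder:
  fixes x y :: "'i \<Rightarrow> real"
  assumes "finite I" and x: "\<And>i. i \<in> I \<Longrightarrow> 0 \<le> x i" and y: "\<And>i. i \<in> I \<Longrightarrow> 0 \<le> y i" and t: "0 < t" "t < 1"
  shows "(\<Sum>i\<in>I. x i powr t * y i powr (1 - t)) \<le> (\<Sum>i\<in>I. x i) powr t * (\<Sum>i\<in>I. y i) powr (1 - t)"
proof -
  \<comment> \<open>Hoelder for the counting measure on \<open>I\<close>. The absolute values
    provide nonnegativity at every index, while \<open>x\<close> and \<open>y\<close> are known to
    be nonnegative on \<open>I\<close> only.\<close>
  have "(\<integral>\<^sup>+i. ennreal (\<bar>x i\<bar> powr t * \<bar>y i\<bar> powr (1 - t)) \<partial>count_space I)
    \<le> ennreal ((\<Sum>i\<in>I. \<bar>x i\<bar>) powr t * (\<Sum>i\<in>I. \<bar>y i\<bar>) powr (1 - t))"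
    using assms(1) t by (intro nn_integral_Holder) (auto simp: nn_integral_count_space_finite sum_nonneg)
  then have "ennreal (\<Sum>i\<in>I. \<bar>x i\<bar> powr t * \<bar>y i\<bar> powr (1 - t)) 
    \<le> ennreal ((\<Sum>i\<in>I. \<bar>x i\<bar>) powr t * (\<Sum>i\<in>I. \<bar>y i\<bar>) powr (1 - t))"
    using assms(1) by (simp add: nn_integral_count_space_finite)
  then have "(\<Sum>i\<in>I. \<bar>x i\<bar> powr t * \<bar>y i\<bar> powr (1 - t)) 
    \<le> (\<Sum>i\<in>I. \<bar>x i\<bar>) powr t * (\<Sum>i\<in>I. \<bar>y i\<bar>) powr (1 - t)"
    by (subst (asm) ennreal_le_iff) (auto intro!: mult_nonneg_nonneg)
  then show ?thesis using x y by simp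
qed

text \<open>This is where the exponent \<alpha> arises. \<open>a\<close> and \<open>c\<close> are
  averages of \<sigma> and \<tau> over a cube, \<open>a'\<close> and \<open>c'\<close> the parts
  carried by E_S. The left side is the 1/r-th power of the product bounded by \<open>Y\<close>,
  times \<open>a powr (1/r) * c powr ((r-1)/r)\<close>. Replacing \<open>a\<close>, \<open>c\<close>
  by \<open>a'\<close>, \<open>c'\<close> costs powers of the ratios \<open>a/a'\<close> and
  \<open>c/c'\<close>. Both ratios are at least 1, so their exponents may be raised until the two
  appear in the combination bounded by \<open>Y / k\<close>, with a common outer power
  \<open>m\<close>. The total power of \<open>Y\<close> is 1/r + m = \<alpha>.\<close>

lemma weighted_exponent_bound:
  fixes a c a' c' k Y p q r :: real
  assumes pqr: "1 \<le> p" "p < r" "r < q"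
    and a: "0 < a'" "a' \<le> a" and c: "0 < c'" "c' \<le> c"
    and Y: "a powr ((r - p) / p) * c powr ((q - r) / q) \<le> Y"
    and k: "0 < k" "k \<le> a' powr ((r - p) / p) * c' powr ((q - r) / q)"
  shows "a powr (1 / p) * c powr ((q - 1) / q)
    \<le> (1 / k) powr max (p / (r * (r - p))) (q * (r - 1) / (r * (q - r)))
       * Y powr max (1 / (r - p)) ((q - 1) / (q - r)) * (a' powr (1 / r) * c' powr ((r - 1) / r))"
proof -
  define m where "m = max (p / (r * (r - p))) (q * (r - 1) / (r * (q - r)))"
  define \<alpha> where "\<alpha> = max (1 / (r - p)) ((q - 1) / (q - r))"
  define x where "x = a / a'"
  define y where "y = c / c'"
  have pos: "0 < p" "0 < q" "0 < r" "0 < r - p" "0 < q - r" "0 \<le> r - 1" using pqr by auto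
  have pos2: "0 < a" "0 < c" "1 \<le> x" "1 \<le> y" using a c by (auto simp: x_def y_def)
  have Y0: "0 < Y"
    using pos2 Y by (intro less_le_trans[OF _ Y] mult_pos_pos) auto
  have m0: "0 \<le> m" using pos by (simp add: m_def le_max_iff_disj)
  have "1 / r + p / (r * (r - p)) = 1 / (r - p)" "1 / r + q * (r - 1) / (r * (q - r)) = (q - 1) / (q - r)"
    using pos by (simp_all add: divide_simps) (simp_all add: algebra_simps)
  then have \<alpha>: "\<alpha> = 1 / r + m"
    unfolding \<alpha>_def m_def by (simp add: max_add_distrib_right)
  have "a powr (1 / p) = (a powr ((r - p) / p)) powr (1 / r) * a powr (1 / r)"
    using pos pos2 by (simp add: powr_powr flip: powr_add) (simp add: field_simps)
  moreover have "(q - 1) / q = (q - r) / q * (1 / r) + (r - 1) / r"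
    using pos by (simp add: field_simps)
  then have "c powr ((q - 1) / q) = (c powr ((q - r) / q)) powr (1 / r) * c powr ((r - 1) / r)"
    using pos2 by (simp only: powr_powr powr_add)
  ultimately have "a powr (1 / p) * c powr ((q - 1) / q)
     = (a powr ((r - p) / p) * c powr ((q - r) / q)) powr (1 / r) * (a powr (1 / r) * c powr ((r - 1) / r))"
    by (simp add: powr_mult mult_ac)
  also have "\<dots> \<le> Y powr (1 / r) * (a powr (1 / r) * c powr ((r - 1) / r))"
    using pos Y by (intro mult_right_mono powr_mono2) auto
  also have "a powr (1 / r) * c powr ((r - 1) / r) 
     = (x powr (1 / r) * y powr ((r - 1) / r)) * (a' powr (1 / r) * c' powr ((r - 1) / r))"
    using a c pos2 by (simp add: x_def y_def powr_divide)
  also have "x powr (1 / r) * y powr ((r - 1) / r) \<le> (Y / k) powr m"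
  proof -
    have "x powr (1 / r) = (x powr ((r - p) / p)) powr (p / (r * (r - p)))"
      using pos by (simp add: powr_powr)
    also have "\<dots> \<le> (x powr ((r - p) / p)) powr m"
      using pos pos2 by (intro powr_mono ge_one_powr_ge_zero) (auto simp: m_def)
    finally have X: "x powr (1 / r) \<le> (x powr ((r - p) / p)) powr m" .
    have "y powr ((r - 1) / r) = (y powr ((q - r) / q)) powr (q * (r - 1) / (r * (q - r)))"
      using pos by (simp add: powr_powr)
    also have "\<dots> \<le> (y powr ((q - r) / q)) powr m"
      using pos pos2 by (intro powr_mono ge_one_powr_ge_zero) (auto simp: m_def)
    finally have "x powr (1 / r) * y powr ((r - 1) / r) \<le> (x powr ((r - p) / p)) powr m * (y powr ((q - r) / q)) powr m"
      using X by (intro mult_mono) auto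
    also have "\<dots> = ((a powr ((r - p) / p) * c powr ((q - r) / q)) / (a' powr ((r - p) / p) * c' powr ((q - r) / q))) powr m"
      using a c pos2 by (simp add: x_def y_def powr_divide powr_mult)
    also have "\<dots> \<le> (Y / k) powr m"
      using m0 Y k a c Y0 by (intro powr_mono2 frac_le) auto
    finally show ?thesis .
  qed
  also have "(Y / k) powr m = (1 / k) powr m * Y powr m"
    using k Y0 by (simp add: powr_divide)
  finally have "a powr (1 / p) * c powr ((q - 1) / q) 
    \<le> Y powr (1 / r) * ((1 / k) powr m * Y powr m * (a' powr (1 / r) * c' powr ((r - 1) / r)))"
    using a c by (simp add: mult_left_mono mult_right_mono)
  also have "\<dots> = (1 / k) powr m * Y powr \<alpha> * (a' powr (1 / r) * c' powr ((r - 1) / r))"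
    by (simp add: \<alpha> powr_add mult_ac)
  finally show ?thesis unfolding m_def \<alpha>_def .
qed

text \<open>The maximal estimate for the measure with density \<sigma>, applied to
  \<open>u = F / \<sigma>\<close>: the average of \<open>u\<close> over \<open>Q i\<close> in this
  measure is \<open>f i / a i\<close>, and the integral of \<open>u powr s\<close> becomes that of
  \<open>F powr s * \<sigma> powr (1 - s)\<close>. Unweighted averages are thus controlled by a
  maximal theorem whose constant does not see the weight.\<close>

lemma weighted_laminar_Carleson:
  fixes F \<sigma> :: "'a \<Rightarrow> real" and w a f :: "'i \<Rightarrow> real" and s :: real
  assumes M: "sigma_finite_measure M"
    and I: "finite I" "laminar (Q ` I)" and Q: "\<And>i. i \<in> I \<Longrightarrow> Q i \<in> sets M"
    and E: "\<And>i. i \<in> I \<Longrightarrow> E i \<in> sets M" "\<And>i. i \<in> I \<Longrightarrow> E i \<subseteq> Q i" "disjoint_family_on E I"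
    and F[measurable]: "F \<in> borel_measurable M" and F0: "\<And>x. 0 \<le> F x"
    and \<sigma>[measurable]: "\<sigma> \<in> borel_measurable M" and \<sigma>0: "\<And>x. 0 < \<sigma> x"
    and w: "\<And>i. i \<in> I \<Longrightarrow> 0 < w i" and a: "\<And>i. i \<in> I \<Longrightarrow> 0 < a i" and f: "\<And>i. i \<in> I \<Longrightarrow> 0 \<le> f i"
    and int\<sigma>: "\<And>i. i \<in> I \<Longrightarrow> (\<integral>\<^sup>+x\<in>Q i. ennreal (\<sigma> x) \<partial>M) = ennreal (w i * a i)"
    and intF: "\<And>i. i \<in> I \<Longrightarrow> (\<integral>\<^sup>+x\<in>Q i. ennreal (F x) \<partial>M) = ennreal (w i * f i)"
    and s: "1 < s"
  shows "(\<Sum>i\<in>I. ennreal ((f i / a i) powr s) * (\<integral>\<^sup>+x\<in>E i. ennreal (\<sigma> x) \<partial>M))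
     \<le> ennreal (4 powr s / (s - 1)) * (\<integral>\<^sup>+x. ennreal (F x powr s * \<sigma> x powr (1 - s)) \<partial>M)"
proof -
  define N where "N = density M (\<lambda>x. ennreal (\<sigma> x))"
  define u where "u x = F x / \<sigma> x" for x
  have setsN[simp]: "sets N = sets M" by (simp add: N_def)
  have u_meas: "u \<in> borel_measurable M" unfolding u_def by measurable
  then have u_measN: "u \<in> borel_measurable N" by (simp cong: measurable_cong_sets)
  have N: "sigma_finite_measure N"
    unfolding N_def using sigma_finite_measure.sigma_finite_iff_density_finite[OF M, of "\<lambda>x. ennreal (\<sigma> x)"] by auto
  have NQ: "emeasure N (Q i) = ennreal (w i * a i)" if "i \<in> I" for i
    using Q[OF that] int\<sigma>[OF that] by (simp add: N_def emeasure_density)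
  have NE: "emeasure N (E i) = (\<integral>\<^sup>+x\<in>E i. ennreal (\<sigma> x) \<partial>M)" if "i \<in> I" for i
    using E(1)[OF that] by (simp add: N_def emeasure_density)
  have uF: "ennreal (\<sigma> x) * ennreal (u x) = ennreal (F x)" for x
    using \<sigma>0[of x] F0[of x] by (simp add: u_def flip: ennreal_mult)
  have "(\<Sum>i\<in>I. ennreal ((f i / a i) powr s) * emeasure N (E i))
     \<le> ennreal (4 powr s / (s - 1)) * (\<integral>\<^sup>+x. ennreal (u x powr s) \<partial>N)"
  proof (rule laminar_Carleson[OF N I _ _ _ E(2,3) u_measN _ _ _ s])
    fix i assume i: "i \<in> I"
    show "Q i \<in> sets N" "E i \<in> sets N" using Q E i by auto
    show "emeasure N (Q i) < \<infinity>" using NQ[OF i] by simp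
    show "0 \<le> f i / a i" using a[OF i] f[OF i] by simp
    have "(\<integral>\<^sup>+x\<in>Q i. ennreal (u x) \<partial>N) = (\<integral>\<^sup>+x. ennreal (\<sigma> x) * (ennreal (u x) * indicator (Q i) x) \<partial>M)"
      unfolding N_def using u_meas Q[OF i] by (intro nn_integral_density) auto
    also have "\<dots> = (\<integral>\<^sup>+x\<in>Q i. ennreal (F x) \<partial>M)"
      by (simp only: mult.assoc[symmetric] uF)
    also have "\<dots> = ennreal (w i * f i)" by (rule intF[OF i])
    also have "\<dots> = ennreal (f i / a i) * ennreal (w i * a i)"
      using a[OF i] w[OF i] f[OF i] by (simp add: mult_ac flip: ennreal_mult)
    finally show "ennreal (f i / a i) * emeasure N (Q i) \<le> (\<integral>\<^sup>+x\<in>Q i. ennreal (u x) \<partial>N)"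
      unfolding NQ[OF i] by simp
  next
    show "0 \<le> u x" for x using F0[of x] \<sigma>0[of x] by (simp add: u_def)
  qed
  also have "(\<integral>\<^sup>+x. ennreal (u x powr s) \<partial>N) = (\<integral>\<^sup>+x. ennreal (\<sigma> x) * ennreal (u x powr s) \<partial>M)"
    unfolding N_def using u_meas by (intro nn_integral_density) auto
  also have "\<dots> = (\<integral>\<^sup>+x. ennreal (F x powr s * \<sigma> x powr (1 - s)) \<partial>M)"
  proof (rule nn_integral_cong)
    fix x
    have "\<sigma> x * u x powr s = F x powr s * \<sigma> x powr (1 - s)"
      using \<sigma>0[of x] F0[of x] by (simp add: u_def powr_divide powr_diff)
    then show "ennreal (\<sigma> x) * ennreal (u x powr s) = ennreal (F x powr s * \<sigma> x powr (1 - s))"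
      using \<sigma>0[of x] by (simp flip: ennreal_mult')
  qed
  also have "(\<Sum>i\<in>I. ennreal ((f i / a i) powr s) * emeasure N (E i)) 
    = (\<Sum>i\<in>I. ennreal ((f i / a i) powr s) * (\<integral>\<^sup>+x\<in>E i. ennreal (\<sigma> x) \<partial>M))"
    by (intro sum.cong) (simp_all add: NE)
  finally show ?thesis .
qed

text \<open>Here \<open>F\<close> and \<open>G\<close> stand for |f|^p and |g|^q', and
  \<open>a\<close>, \<open>c\<close>, \<open>f\<close>, \<open>g\<close> for averages of \<sigma>,
  \<tau>, \<open>F\<close>, \<open>G\<close> with common denominator \<open>w i\<close>. They are
  passed as real numbers so that all exponent arithmetic takes place in the reals. The exponent
  \<open>r * (q - 1) / ((r - 1) * q)\<close> is r'/q', the counterpart of r/p on the side of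
  g.\<close>

lemma laminar_sparse_form_bound:
  fixes F G \<sigma> \<tau> :: "'a \<Rightarrow> real" and w a c f g :: "'i \<Rightarrow> real" and p q r Y \<kappa> A B d :: real
    and K :: "real \<Rightarrow> real"
  assumes M: "sigma_finite_measure M"
    and pqr: "1 \<le> p" "p < r" "r < q"
    and I: "finite I" "laminar (Q ` I)" and Q: "\<And>i. i \<in> I \<Longrightarrow> Q i \<in> sets M"
    and E: "\<And>i. i \<in> I \<Longrightarrow> E i \<in> sets M" "\<And>i. i \<in> I \<Longrightarrow> E i \<subseteq> Q i" "disjoint_family_on E I"
    and \<kappa>: "0 < \<kappa>" "\<And>i. i \<in> I \<Longrightarrow> ennreal (\<kappa> * w i) \<le> emeasure M (E i)"
    and F[measurable]: "F \<in> borel_measurable M" and F0: "\<And>x. 0 \<le> F x"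
    and G[measurable]: "G \<in> borel_measurable M" and G0: "\<And>x. 0 \<le> G x"
    and \<sigma>[measurable]: "\<sigma> \<in> borel_measurable M" and \<sigma>0: "\<And>x. 0 < \<sigma> x"
    and \<tau>[measurable]: "\<tau> \<in> borel_measurable M" and \<tau>0: "\<And>x. 0 < \<tau> x"
    and dual: "\<And>x. \<sigma> x powr ((r - p) / p) * \<tau> x powr ((q - r) / q) = 1"
    and w: "\<And>i. i \<in> I \<Longrightarrow> 0 < w i"
    and a: "\<And>i. i \<in> I \<Longrightarrow> 0 < a i" and c: "\<And>i. i \<in> I \<Longrightarrow> 0 < c i"
    and f: "\<And>i. i \<in> I \<Longrightarrow> 0 \<le> f i" and g: "\<And>i. i \<in> I \<Longrightarrow> 0 \<le> g i"
    and int\<sigma>: "\<And>i. i \<in> I \<Longrightarrow> (\<integral>\<^sup>+x\<in>Q i. ennreal (\<sigma> x) \<partial>M) = ennreal (w i * a i)"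
    and int\<tau>: "\<And>i. i \<in> I \<Longrightarrow> (\<integral>\<^sup>+x\<in>Q i. ennreal (\<tau> x) \<partial>M) = ennreal (w i * c i)"
    and intF: "\<And>i. i \<in> I \<Longrightarrow> (\<integral>\<^sup>+x\<in>Q i. ennreal (F x) \<partial>M) = ennreal (w i * f i)"
    and intG: "\<And>i. i \<in> I \<Longrightarrow> (\<integral>\<^sup>+x\<in>Q i. ennreal (G x) \<partial>M) = ennreal (w i * g i)"
    and Y: "\<And>i. i \<in> I \<Longrightarrow> a i powr ((r - p) / p) * c i powr ((q - r) / q) \<le> Y"
    and AB: "0 \<le> A" "0 \<le> B"
    and A: "(\<integral>\<^sup>+x. ennreal (F x powr (r / p) * \<sigma> x powr (1 - r / p)) \<partial>M) = ennreal A"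
    and B: "(\<integral>\<^sup>+x. ennreal (G x powr (r * (q - 1) / ((r - 1) * q)) 
              * \<tau> x powr (1 - r * (q - 1) / ((r - 1) * q))) \<partial>M) = ennreal B"
  defines "d \<equiv> (r - p) / p + (q - r) / q"
    and "K \<equiv> \<lambda>s. 4 powr s / (s - 1)"
  shows "(\<Sum>i\<in>I. w i * f i powr (1 / p) * g i powr ((q - 1) / q))
    \<le> (1 / \<kappa> powr d) powr max (p / (r * (r - p))) (q * (r - 1) / (r * (q - r)))
       * K (r / p) powr (1 / r) * K (r * (q - 1) / ((r - 1) * q)) powr ((r - 1) / r)
       * Y powr max (1 / (r - p)) ((q - 1) / (q - r)) * A powr (1 / r) * B powr ((r - 1) / r)"
proof -
  define s where "s = r / p"
  define s' where "s' = r * (q - 1) / ((r - 1) * q)"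
  define \<theta> where "\<theta> = ((r - p) / p) / d"
  define D where "D = (1 / \<kappa> powr d) powr max (p / (r * (r - p))) (q * (r - 1) / (r * (q - r)))"
  define \<alpha> where "\<alpha> = max (1 / (r - p)) ((q - 1) / (q - r))"
  have pos: "0 < p" "0 < q" "0 < r" "0 < r - p" "0 < q - r" "0 < r - 1" "0 < q - 1" using pqr by auto
  have s: "1 < s" "1 < s'" using pos unfolding s_def s'_def by (simp_all add: field_simps)
  have d: "0 < d" "0 < (r - p) / p" "0 < (q - r) / q" using pos by (auto simp: d_def intro!: add_pos_pos)
  \<comment> \<open>Dividing the exponents of \<open>dual\<close> by their sum \<open>d\<close>
    gives the weights \<theta> and 1 - \<theta> that Hoelder requires; the power \<open>d\<close>
    below undoes this.\<close>
  have \<theta>: "0 < \<theta>" "\<theta> < 1" "1 - \<theta> = ((q - r) / q) / d"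
  proof -
    have "\<theta> + ((q - r) / q) / d = 1"
      unfolding \<theta>_def add_divide_distrib[symmetric] d_def[symmetric] using d by simp
    moreover have "0 < ((q - r) / q) / d" "0 < \<theta>" unfolding \<theta>_def using d pos by simp_all
    ultimately show "0 < \<theta>" "\<theta> < 1" "1 - \<theta> = ((q - r) / q) / d" by linarith+
  qed
  have unit: "\<sigma> x powr \<theta> * \<tau> x powr (1 - \<theta>) = 1" for x
  proof -
    have "(\<sigma> x powr ((r - p) / p) * \<tau> x powr ((q - r) / q)) powr (1 / d) = 1" unfolding dual by simp
    then show ?thesis unfolding \<theta>(3) by (simp add: powr_mult powr_powr \<theta>_def)
  qed
  \<comment> \<open>The masses on \<open>E i\<close> are divided by the same \<open>w i\<close> as
    the averages over \<open>Q i\<close>, so that \<open>Ew h i\<close> is at most the corresponding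
    average.\<close>
  define Ew :: "('a \<Rightarrow> real) \<Rightarrow> 'i \<Rightarrow> real" where
    "Ew h i = enn2real (\<integral>\<^sup>+x\<in>E i. ennreal (h x) \<partial>M) / w i" for h i
  have Ew: "(\<integral>\<^sup>+x\<in>E i. ennreal (h x) \<partial>M) = ennreal (w i * Ew h i)" "0 \<le> Ew h i" "Ew h i \<le> z"
    if i: "i \<in> I" and h: "(\<integral>\<^sup>+x\<in>Q i. ennreal (h x) \<partial>M) = ennreal (w i * z)" "0 < z" for i h z
  proof -
    have le: "(\<integral>\<^sup>+x\<in>E i. ennreal (h x) \<partial>M) \<le> ennreal (w i * z)"
      unfolding h(1)[symmetric] using E(2)[OF i] by (intro nn_integral_mono) (auto split: split_indicator)
    then have fin: "(\<integral>\<^sup>+x\<in>E i. ennreal (h x) \<partial>M) < top" by (rule le_less_trans) simp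
    show eq: "(\<integral>\<^sup>+x\<in>E i. ennreal (h x) \<partial>M) = ennreal (w i * Ew h i)" 
      using fin w[OF i] by (simp add: Ew_def)
    show nn: "0 \<le> Ew h i" using w[OF i] by (simp add: Ew_def)
    have "w i * Ew h i \<le> w i * z" using le h(2) w[OF i] unfolding eq by (subst (asm) ennreal_le_iff) auto
    then show "Ew h i \<le> z" using w[OF i] by simp
  qed
  note E\<sigma> = Ew[OF _ int\<sigma> a] and E\<tau> = Ew[OF _ int\<tau> c]
  \<comment> \<open>By \<open>unit\<close> the indicator of \<open>E i\<close> is a Hoelder product
    of \<sigma> and \<tau> restricted to \<open>E i\<close>, so a set of substantial measure forces
    the product of their masses to be bounded below.\<close>
  have fat: "\<kappa> powr d \<le> Ew \<sigma> i powr ((r - p) / p) * Ew \<tau> i powr ((q - r) / q)" if i: "i \<in> I" for i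
  proof -
    note wi = w[OF i]
    have "ennreal (\<kappa> * w i) \<le> emeasure M (E i)" by (rule \<kappa>(2)[OF i])
    also have "\<dots> = (\<integral>\<^sup>+x. ennreal (indicator (E i) x) \<partial>M)"
      using E(1)[OF i] by (simp add: ennreal_indicator)
    also have "\<dots> = (\<integral>\<^sup>+x. ennreal ((\<sigma> x * indicator (E i) x) powr \<theta> * (\<tau> x * indicator (E i) x) powr (1 - \<theta>)) \<partial>M)"
      by (intro nn_integral_cong arg_cong[where f=ennreal]) (auto simp: unit split: split_indicator)
    also have "\<dots> \<le> ennreal ((w i * Ew \<sigma> i) powr \<theta> * (w i * Ew \<tau> i) powr (1 - \<theta>))"
    proof (rule nn_integral_Holder[OF _ _ _ _ _ _ \<theta>(1,2)])
      show "(\<integral>\<^sup>+x. ennreal (\<sigma> x * indicator (E i) x) \<partial>M) = ennreal (w i * Ew \<sigma> i)"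
        unfolding E\<sigma>(1)[OF i i i, symmetric] by (intro nn_integral_cong) (auto split: split_indicator)
      show "(\<integral>\<^sup>+x. ennreal (\<tau> x * indicator (E i) x) \<partial>M) = ennreal (w i * Ew \<tau> i)"
        unfolding E\<tau>(1)[OF i i i, symmetric] by (intro nn_integral_cong) (auto split: split_indicator)
      show "0 \<le> w i * Ew \<sigma> i" "0 \<le> w i * Ew \<tau> i" 
        using wi E\<sigma>(2)[OF i i i] E\<tau>(2)[OF i i i] by auto
      show "(\<lambda>x. \<sigma> x * indicator (E i) x) \<in> borel_measurable M" "(\<lambda>x. \<tau> x * indicator (E i) x) \<in> borel_measurable M"
        using E(1)[OF i] by measurable
    qed (use \<sigma>0 \<tau>0 in \<open>auto simp: less_imp_le\<close>)
    finally have "\<kappa> * w i \<le> (w i * Ew \<sigma> i) powr \<theta> * (w i * Ew \<tau> i) powr (1 - \<theta>)"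
      by (subst (asm) ennreal_le_iff) auto
    also have "\<dots> = (Ew \<sigma> i powr \<theta> * Ew \<tau> i powr (1 - \<theta>)) * (w i powr \<theta> * w i powr (1 - \<theta>))"
      by (simp add: powr_mult)
    also have "w i powr \<theta> * w i powr (1 - \<theta>) = w i" using wi by (simp flip: powr_add)
    finally have "\<kappa> \<le> Ew \<sigma> i powr \<theta> * Ew \<tau> i powr (1 - \<theta>)" using wi by simp
    then have "\<kappa> powr d \<le> (Ew \<sigma> i powr \<theta> * Ew \<tau> i powr (1 - \<theta>)) powr d"
      using \<kappa> d by (intro powr_mono2) auto
    also have "\<dots> = Ew \<sigma> i powr ((r - p) / p) * Ew \<tau> i powr ((q - r) / q)"
      unfolding \<theta>(3) using d by (simp add: powr_mult powr_powr \<theta>_def)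
    finally show ?thesis .
  qed
  have Epos: "0 < Ew \<sigma> i" "0 < Ew \<tau> i" if i: "i \<in> I" for i
  proof -
    have "0 < \<kappa> powr d" using \<kappa> by simp
    then have "Ew \<sigma> i powr ((r - p) / p) * Ew \<tau> i powr ((q - r) / q) \<noteq> 0" using fat[OF i] by linarith
    then have "Ew \<sigma> i \<noteq> 0" "Ew \<tau> i \<noteq> 0" by auto
    then show "0 < Ew \<sigma> i" "0 < Ew \<tau> i" using E\<sigma>(2)[OF i i i] E\<tau>(2)[OF i i i] by auto
  qed
  define X where "X i = (f i / a i) powr s * (w i * Ew \<sigma> i)" for i
  define Z where "Z i = (g i / c i) powr s' * (w i * Ew \<tau> i)" for i
  have X0: "0 \<le> X i" and Z0: "0 \<le> Z i" if "i \<in> I" for i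
    using w[OF that] Epos[OF that] by (auto simp: X_def Z_def)
  have sumX: "(\<Sum>i\<in>I. X i) \<le> K s * A"
  proof -
    have "(\<Sum>i\<in>I. ennreal (X i)) = (\<Sum>i\<in>I. ennreal ((f i / a i) powr s) * (\<integral>\<^sup>+x\<in>E i. ennreal (\<sigma> x) \<partial>M))"
      by (intro sum.cong refl) (simp add: X_def E\<sigma>(1) ennreal_mult')
    also have "\<dots> \<le> ennreal (K s) * ennreal A"
      unfolding A[symmetric] K_def s_def[symmetric]
      by (rule weighted_laminar_Carleson[OF M I Q E F F0 \<sigma> \<sigma>0 w a f int\<sigma> intF s(1)])
    also have "\<dots> = ennreal (K s * A)"
      using s AB by (intro ennreal_mult[symmetric]) (auto simp: K_def)
    finally have "ennreal (\<Sum>i\<in>I. X i) \<le> ennreal (K s * A)"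
      using X0 by (simp add: sum_ennreal)
    then show ?thesis using s AB by (subst (asm) ennreal_le_iff) (auto simp: K_def)
  qed
  have sumZ: "(\<Sum>i\<in>I. Z i) \<le> K s' * B"
  proof -
    have "(\<Sum>i\<in>I. ennreal (Z i)) = (\<Sum>i\<in>I. ennreal ((g i / c i) powr s') * (\<integral>\<^sup>+x\<in>E i. ennreal (\<tau> x) \<partial>M))"
      by (intro sum.cong refl) (simp add: Z_def E\<tau>(1) ennreal_mult')
    also have "\<dots> \<le> ennreal (K s') * ennreal B"
      unfolding B[symmetric] K_def s'_def[symmetric]
      by (rule weighted_laminar_Carleson[OF M I Q E G G0 \<tau> \<tau>0 w c g int\<tau> intG s(2)])
    also have "\<dots> = ennreal (K s' * B)"
      using s AB by (intro ennreal_mult[symmetric]) (auto simp: K_def)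
    finally have "ennreal (\<Sum>i\<in>I. Z i) \<le> ennreal (K s' * B)"
      using Z0 by (simp add: sum_ennreal)
    then show ?thesis using s AB by (subst (asm) ennreal_le_iff) (auto simp: K_def)
  qed
  \<comment> \<open>Splitting f^(1/p) into (f/a)^(1/p) a^(1/p), and the factor of g likewise,
    isolates the weight averages, which are then traded for masses on \<open>E i\<close>. The
    outcome is a product of powers of \<open>X i\<close> and \<open>Z i\<close> because s/r = 1/p
    and s' (r-1)/r = (q-1)/q.\<close>
  have term_le: "w i * f i powr (1 / p) * g i powr ((q - 1) / q)
      \<le> D * Y powr \<alpha> * (X i powr (1 / r) * Z i powr (1 - 1 / r))" if i: "i \<in> I" for i
  proof -
    have "a i powr (1 / p) * c i powr ((q - 1) / q)
      \<le> D * Y powr \<alpha> * (Ew \<sigma> i powr (1 / r) * Ew \<tau> i powr ((r - 1) / r))"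
      unfolding D_def \<alpha>_def
      using \<kappa> by (intro weighted_exponent_bound[OF pqr Epos(1)[OF i] E\<sigma>(3)[OF i i i] Epos(2)[OF i] E\<tau>(3)[OF i i i] Y[OF i] _ fat[OF i]]) simp
    moreover define W where "W = w i * (f i / a i) powr (1 / p) * (g i / c i) powr ((q - 1) / q)"
    ultimately have le: "W * (a i powr (1 / p) * c i powr ((q - 1) / q))
      \<le> W * (D * Y powr \<alpha> * (Ew \<sigma> i powr (1 / r) * Ew \<tau> i powr ((r - 1) / r)))"
      using w[OF i] by (intro mult_left_mono) auto
    have W: "W * (a i powr (1 / p) * c i powr ((q - 1) / q))
       = w i * f i powr (1 / p) * g i powr ((q - 1) / q)"
      using a[OF i] c[OF i] f[OF i] g[OF i] by (simp add: powr_divide W_def)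
    have XZ: "W * (Ew \<sigma> i powr (1 / r) * Ew \<tau> i powr ((r - 1) / r)) = X i powr (1 / r) * Z i powr (1 - 1 / r)"
    proof -
      have e: "1 - 1 / r = (r - 1) / r" "s * (1 / r) = 1 / p" "s' * ((r - 1) / r) = (q - 1) / q"
        using pos by (simp_all add: s_def s'_def field_simps)
      have wi: "w i powr (1 / r) * w i powr ((r - 1) / r) = w i"
        using w[OF i] unfolding e(1)[symmetric] by (simp flip: powr_add)
      have "X i powr (1 / r) * Z i powr (1 - 1 / r) 
        = (w i powr (1 / r) * w i powr ((r - 1) / r)) * (f i / a i) powr (1 / p) * (g i / c i) powr ((q - 1) / q)
         * (Ew \<sigma> i powr (1 / r) * Ew \<tau> i powr ((r - 1) / r))"
        unfolding X_def Z_def e(1) powr_mult powr_powr e(2,3) by (simp only: mult_ac)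
      then show ?thesis unfolding wi W_def by simp
    qed
    have eq: "W * (D * Y powr \<alpha> * (Ew \<sigma> i powr (1 / r) * Ew \<tau> i powr ((r - 1) / r)))
      = D * Y powr \<alpha> * (W * (Ew \<sigma> i powr (1 / r) * Ew \<tau> i powr ((r - 1) / r)))"
      by (simp only: mult_ac)
    show ?thesis using le unfolding eq W XZ .
  qed
  have D0: "0 \<le> D * Y powr \<alpha>" by (simp add: D_def)
  have "(\<Sum>i\<in>I. w i * f i powr (1 / p) * g i powr ((q - 1) / q))
    \<le> (\<Sum>i\<in>I. D * Y powr \<alpha> * (X i powr (1 / r) * Z i powr (1 - 1 / r)))"
    by (rule sum_mono[OF term_le])
  also have "\<dots> = D * Y powr \<alpha> * (\<Sum>i\<in>I. X i powr (1 / r) * Z i powr (1 - 1 / r))"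
    by (simp add: sum_distrib_left)
  also have "\<dots> \<le> D * Y powr \<alpha> * ((\<Sum>i\<in>I. X i) powr (1 / r) * (\<Sum>i\<in>I. Z i) powr (1 - 1 / r))"
    using I X0 Z0 pos by (intro mult_left_mono[OF _ D0] sum_Holder) auto
  also have "\<dots> \<le> D * Y powr \<alpha> * ((K s * A) powr (1 / r) * (K s' * B) powr (1 - 1 / r))"
    using sumX sumZ X0 Z0 pos
    by (intro mult_left_mono[OF _ D0] mult_mono powr_mono2) (auto intro: sum_nonneg)
  also have "\<dots> = D * K s powr (1 / r) * K s' powr ((r - 1) / r) * Y powr \<alpha> * A powr (1 / r) * B powr ((r - 1) / r)"
  proof -
    have e: "1 - 1 / r = (r - 1) / r" using pos by (simp add: field_simps)
    show ?thesis unfolding e powr_mult by (simp only: mult_ac)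
  qed
  finally show ?thesis unfolding D_def \<alpha>_def s_def s'_def .
qed

section \<open>Shifted dyadic grids of anisotropic cubes\<close>

text \<open>
  The one-third trick. The alternating sign makes the grid shifted by a third of the side length
  nested across scales, since \<open>1/3\<close> and \<open>-2/3\<close> differ by an integer.
\<close>

definition grid_shift :: "bool \<Rightarrow> int \<Rightarrow> int" where
  "grid_shift e N = (if e then if even N then 1 else - 1 else 0)"

text \<open>The index k of the half-open interval of length 2^N that starts at 2^N (k + shift/3) and
  contains \<open>x\<close>. With integer indices, nesting of grids becomes dependence of one index
  on another.\<close>

definition grid_index :: "bool \<Rightarrow> int \<Rightarrow> real \<Rightarrow> int" where
  "grid_index e N x = \<lfloor>x / 2 powi N - of_int (grid_shift e N) / 3\<rfloor>"

text \<open>With shift s at level N and -s at level N + 1, the scaled position z = x/2^N - s/3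
  becomes z/2 + s/6 + s/3 = (z + s)/2. The integer s leaves the floor, so the coarse index is a
  function of the fine one.\<close>

lemma grid_index_Suc: "grid_index e (N + 1) x = (grid_index e N x + grid_shift e N) div 2"
proof -
  define z where "z = x / 2 powi N - of_int (grid_shift e N) / 3"
  have "grid_shift e (N + 1) = - grid_shift e N" by (simp add: grid_shift_def)
  then have "x / 2 powi (N + 1) - of_int (grid_shift e (N + 1)) / 3 = (z + of_int (grid_shift e N)) / of_int 2"
    by (simp add: z_def power_int_add field_simps)
  then have "grid_index e (N + 1) x = \<lfloor>(z + of_int (grid_shift e N)) / of_int 2\<rfloor>"
    by (simp only: grid_index_def)
  also have "\<dots> = \<lfloor>z + of_int (grid_shift e N)\<rfloor> div 2"
    by (rule floor_divide_real_eq_div) simp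
  also have "\<dots> = (\<lfloor>z\<rfloor> + grid_shift e N) div 2" by simp
  finally show ?thesis by (simp only: grid_index_def z_def)
qed

lemma grid_index_mono:
  assumes "N \<le> N'" "grid_index e N x = grid_index e N y"
  shows "grid_index e N' x = grid_index e N' y"
  using assms by (induction N' rule: int_ge_induct) (simp_all add: grid_index_Suc)

text \<open>The endpoints of the shifted and the unshifted grid are at least a third of a side
  apart, so an interval no longer than a quarter of a side cannot meet both kinds.\<close>

lemma grid_index_cover:
  assumes l: "0 \<le> l" "4 * l \<le> 2 powi N"
  obtains e where "\<And>y. a \<le> y \<Longrightarrow> y \<le> a + l \<Longrightarrow> grid_index e N y = grid_index e N a"
proof -
  define P :: real where "P = 2 powi N"
  have P: "0 < P" by (simp add: P_def)
  define u where "u = a / P"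
  define v where "v = (a + l) / P"
  have uv: "u \<le> v" "v \<le> u + 1/4" using l P by (simp_all add: u_def v_def P_def field_simps)
  have "\<exists>e. \<lfloor>u - of_int (grid_shift e N) / 3\<rfloor> = \<lfloor>v - of_int (grid_shift e N) / 3\<rfloor>"
  proof (cases "\<lfloor>u\<rfloor> = \<lfloor>v\<rfloor>")
    case True
    then show ?thesis by (intro exI[of _ False]) (simp add: grid_shift_def)
  next
    case False
    define k where "k = \<lfloor>v\<rfloor>"
    have "\<lfloor>u\<rfloor> < k" using False uv floor_mono[of u v] by (simp add: k_def)
    then have k: "u < of_int k" "of_int k \<le> v" unfolding k_def by linarith+
    \<comment> \<open>\<open>k\<close> is the endpoint of the unshifted grid that separates
      \<open>u\<close> from \<open>v\<close>. Both signs of the shift are computed, since the parity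
      of \<open>N\<close> decides which one occurs.\<close>
    have "\<lfloor>u - 1/3\<rfloor> = k - 1" "\<lfloor>v - 1/3\<rfloor> = k - 1" "\<lfloor>u + 1/3\<rfloor> = k" "\<lfloor>v + 1/3\<rfloor> = k"
      using k uv by (simp_all only: floor_eq_iff) linarith+
    then show ?thesis by (intro exI[of _ True]) (simp add: grid_shift_def)
  qed
  then obtain e where e: "\<lfloor>u - of_int (grid_shift e N) / 3\<rfloor> = \<lfloor>v - of_int (grid_shift e N) / 3\<rfloor>" by blast
  have "grid_index e N y = grid_index e N a" if y: "a \<le> y" "y \<le> a + l" for y
  proof -
    have "u \<le> y / P" "y / P \<le> v" using y P by (simp_all add: u_def v_def divide_right_mono)
    then have "\<lfloor>u - of_int (grid_shift e N) / 3\<rfloor> \<le> \<lfloor>y / P - of_int (grid_shift e N) / 3\<rfloor>"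
       "\<lfloor>y / P - of_int (grid_shift e N) / 3\<rfloor> \<le> \<lfloor>v - of_int (grid_shift e N) / 3\<rfloor>"
      by (intro floor_mono; simp)+
    then show ?thesis using e unfolding grid_index_def P_def[symmetric] u_def[symmetric] by linarith
  qed
  then show ?thesis by (rule that)
qed

text \<open>A fibre of the index map at generation \<open>m\<close>. Each coordinate chooses its own
  shift, because the one-third trick may need different answers in different coordinates; this
  yields finitely many grids, one for each \<open>e\<close>.\<close>

definition grid_cell :: "('n::finite \<Rightarrow> real) \<Rightarrow> ('n \<Rightarrow> bool) \<Rightarrow> int \<Rightarrow> real ^ 'n \<Rightarrow> (real ^ 'n) set" where
  "grid_cell b e m x = {y. \<forall>j. grid_index (e j) \<lceil>of_int m * b j\<rceil> (y $ j) = grid_index (e j) \<lceil>of_int m * b j\<rceil> (x $ j)}"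

definition delta_grid :: "('n::finite \<Rightarrow> real) \<Rightarrow> ('n \<Rightarrow> bool) \<Rightarrow> (real ^ 'n) set set" where
  "delta_grid b e = {grid_cell b e m x | m x. True}"

text \<open>Since all \<open>b j\<close> are positive, the exponents
  \<open>\<lceil>of_int m * b j\<rceil>\<close> increase with \<open>m\<close> in every coordinate
  at once. Hence the later generation is coarser in all directions, and two cells that meet are
  nested even though the side lengths grow at different rates.\<close>

lemma laminar_delta_grid:
  assumes b: "\<And>j. b j \<ge> 1"
  shows "laminar (delta_grid b e)"
proof -
  have *: "grid_cell b e m x \<subseteq> grid_cell b e m' x' \<or> grid_cell b e m x \<inter> grid_cell b e m' x' = {}"
    if "m \<le> m'" for m m' x x'
  proof (rule disjCI)
    assume "grid_cell b e m x \<inter> grid_cell b e m' x' \<noteq> {}"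
    then obtain z where z: "z \<in> grid_cell b e m x" "z \<in> grid_cell b e m' x'" by blast
    have "grid_index (e j) \<lceil>of_int m' * b j\<rceil> (y $ j) = grid_index (e j) \<lceil>of_int m' * b j\<rceil> (x' $ j)"
      if "y \<in> grid_cell b e m x" for y j
    proof -
      have "\<lceil>of_int m * b j\<rceil> \<le> \<lceil>of_int m' * b j\<rceil>"
        using \<open>m \<le> m'\<close> b[of j] by (intro ceiling_mono mult_right_mono) auto
      moreover have "grid_index (e j) \<lceil>of_int m * b j\<rceil> (y $ j) = grid_index (e j) \<lceil>of_int m * b j\<rceil> (z $ j)"
        using that z(1) by (simp add: grid_cell_def)
      ultimately have "grid_index (e j) \<lceil>of_int m' * b j\<rceil> (y $ j) = grid_index (e j) \<lceil>of_int m' * b j\<rceil> (z $ j)"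
        by (rule grid_index_mono)
      then show ?thesis using z(2) by (simp add: grid_cell_def)
    qed
    then show "grid_cell b e m x \<subseteq> grid_cell b e m' x'" by (auto simp: grid_cell_def)
  qed
  show ?thesis
    unfolding laminar_def
  proof (intro ballI)
    fix A B assume "A \<in> delta_grid b e" "B \<in> delta_grid b e"
    then obtain m x m' x' where AB: "A = grid_cell b e m x" "B = grid_cell b e m' x'"
      by (auto simp: delta_grid_def)
    show "A \<subseteq> B \<or> B \<subseteq> A \<or> A \<inter> B = {}"
      using *[of m m' x x'] *[of m' m x' x] linear[of m m'] unfolding AB by (auto simp: Int_commute)
  qed
qed

section \<open>Comparison of closed cubes with grid cells\<close>

lemma emeasure_delta_cube:
  fixes a c :: "real ^ 'n::finite"
  assumes "\<And>j. c $ j - a $ j = 2 powi N j"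
  shows "emeasure lebesgue (cbox a c) = ennreal (\<Prod>j\<in>UNIV. 2 powi N j)"
proof -
  have "a $ j \<le> c $ j" for j
  proof -
    have "0 \<le> c $ j - a $ j" unfolding assms by simp
    then show ?thesis by simp
  qed
  then have "cbox a c \<noteq> {}" by (auto simp: interval_ne_empty_cart)
  then have "measure lborel (cbox a c) = (\<Prod>j\<in>UNIV. 2 powi N j)"
    by (simp add: content_cbox_cart assms)
  then show ?thesis
    using emeasure_eq_ennreal_measure[of lborel "cbox a c"] by (simp add: emeasure_lborel_cbox_eq)
qed

text \<open>Cells have to be half-open to be nested or disjoint, whereas the weight constants refer
  to closed cubes. The closed box with the same corners mediates: the difference lies in its
  frontier, which is a null set.\<close>

lemma grid_cell_closure:
  fixes b :: "'n::finite \<Rightarrow> real"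
  obtains C where "C \<in> delta_cubes b" "grid_cell b e m x \<subseteq> C" "C - grid_cell b e m x \<in> null_sets lebesgue"
    "emeasure lebesgue C = ennreal (\<Prod>j\<in>UNIV. 2 powi \<lceil>of_int m * b j\<rceil>)"
proof -
  define N where "N j = \<lceil>of_int m * b j\<rceil>" for j
  define k where "k j = real_of_int (grid_index (e j) (N j) (x $ j)) + of_int (grid_shift (e j) (N j)) / (3::real)" for j
  define lo :: "real ^ 'n" where "lo = (\<chi> j. 2 powi N j * k j)"
  define hi :: "real ^ 'n" where "hi = (\<chi> j. 2 powi N j * (k j + 1))"
  have cell: "y \<in> grid_cell b e m x \<longleftrightarrow> (\<forall>j. lo $ j \<le> y $ j \<and> y $ j < hi $ j)" for y
  proof -
    have "grid_index (e j) (N j) (y $ j) = grid_index (e j) (N j) (x $ j) \<longleftrightarrow> lo $ j \<le> y $ j \<and> y $ j < hi $ j" for j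
    proof -
      have "grid_index (e j) (N j) (y $ j) = grid_index (e j) (N j) (x $ j) \<longleftrightarrow> k j \<le> y $ j / 2 powi N j \<and> y $ j / 2 powi N j < k j + 1"
        unfolding grid_index_def[of "e j" "N j" "y $ j"] floor_eq_iff k_def by (auto simp: algebra_simps)
      also have "\<dots> \<longleftrightarrow> lo $ j \<le> y $ j \<and> y $ j < hi $ j"
        by (simp add: lo_def hi_def pos_le_divide_eq pos_divide_less_eq mult.commute)
      finally show ?thesis .
    qed
    then show ?thesis by (simp add: grid_cell_def N_def)
  qed
  have len: "hi $ j - lo $ j = 2 powi N j" for j by (simp add: hi_def lo_def algebra_simps)
  have "box lo hi \<subseteq> grid_cell b e m x" by (auto simp: cell mem_box_cart less_imp_le)
  then have "negligible (cbox lo hi - grid_cell b e m x)"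
    by (intro negligible_subset[OF negligible_frontier_interval[of lo hi]]) auto
  show ?thesis
  proof
    show "cbox lo hi \<in> delta_cubes b"
      unfolding delta_cubes_def using len by (auto simp: N_def)
    show "grid_cell b e m x \<subseteq> cbox lo hi" by (auto simp: cell mem_box_cart less_imp_le)
    show "cbox lo hi - grid_cell b e m x \<in> null_sets lebesgue" 
      using \<open>negligible _\<close> by (simp add: negligible_iff_null_sets)
    show "emeasure lebesgue (cbox lo hi) = ennreal (\<Prod>j\<in>UNIV. 2 powi \<lceil>of_int m * b j\<rceil>)"
      using emeasure_delta_cube[OF len] by (simp add: N_def)
  qed
qed

text \<open>Two generations suffice: as \<open>b j \<ge> 1\<close>, every exponent grows by at least
  2, so each side becomes at least four times as long, which is what the one-third trick asks for.
  It grows by at most \<open>\<lceil>2 * b j\<rceil>\<close>, whence a volume factor that depends on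
  \<open>b\<close> alone.\<close>

lemma delta_cube_grid_cover:
  fixes b :: "'n::finite \<Rightarrow> real"
  assumes b: "\<And>j. b j \<ge> 1" and S: "S \<in> delta_cubes b"
  obtains e Q C where "Q \<in> delta_grid b e" "S \<subseteq> Q" "C \<in> delta_cubes b" "Q \<subseteq> C" "C - Q \<in> null_sets lebesgue"
    "emeasure lebesgue C \<le> ennreal (\<Prod>j\<in>UNIV. 2 powi \<lceil>2 * b j\<rceil>) * emeasure lebesgue S"
proof -
  obtain a c m where ac: "S = cbox a c" "\<And>j. c $ j - a $ j = 2 powi \<lceil>of_int m * b j\<rceil>"
    using S by (auto simp: delta_cubes_def)
  define N where "N j = \<lceil>of_int m * b j\<rceil>" for j
  define N' where "N' j = \<lceil>of_int (m + 2) * b j\<rceil>" for j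
  have N'N: "N j + 2 \<le> N' j" "N' j \<le> N j + \<lceil>2 * b j\<rceil>" for j
  proof -
    have "\<lceil>of_int m * b j + of_int 2\<rceil> \<le> \<lceil>of_int (m + 2) * b j\<rceil>"
      using b[of j] by (intro ceiling_mono) (simp add: algebra_simps)
    then show "N j + 2 \<le> N' j" by (simp add: N_def N'_def)
    have "of_int (m + 2) * b j = of_int m * b j + 2 * b j" by (simp add: algebra_simps)
    then show "N' j \<le> N j + \<lceil>2 * b j\<rceil>" unfolding N_def N'_def by (simp add: ceiling_add_le)
  qed
  have "\<exists>e. \<forall>y. a $ j \<le> y \<longrightarrow> y \<le> c $ j \<longrightarrow> grid_index e (N' j) y = grid_index e (N' j) (a $ j)" for j
  proof -
    have "4 * (2::real) powi N j = 2 powi (N j + 2)" by (simp add: power_int_add)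
    also have "\<dots> \<le> 2 powi N' j" using N'N by (intro power_int_increasing) auto
    finally have "4 * (c $ j - a $ j) \<le> 2 powi N' j" by (simp add: ac(2) N_def)
    moreover have "0 \<le> c $ j - a $ j" by (simp add: ac(2))
    ultimately obtain e where "\<And>y. a $ j \<le> y \<Longrightarrow> y \<le> a $ j + (c $ j - a $ j) \<Longrightarrow> grid_index e (N' j) y = grid_index e (N' j) (a $ j)"
      using grid_index_cover[of "c $ j - a $ j" "N' j" "a $ j"] by metis
    then show ?thesis by auto
  qed
  then obtain e where e: "\<And>j y. a $ j \<le> y \<Longrightarrow> y \<le> c $ j \<Longrightarrow> grid_index (e j) (N' j) y = grid_index (e j) (N' j) (a $ j)"
    by metis
  obtain C where C: "C \<in> delta_cubes b" "grid_cell b e (m + 2) a \<subseteq> C" "C - grid_cell b e (m + 2) a \<in> null_sets lebesgue"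
    "emeasure lebesgue C = ennreal (\<Prod>j\<in>UNIV. 2 powi N' j)"
    unfolding N'_def by (rule grid_cell_closure)
  show ?thesis
  proof (rule that[OF _ _ C(1-3)])
    show "grid_cell b e (m + 2) a \<in> delta_grid b e" by (auto simp: delta_grid_def)
    show "S \<subseteq> grid_cell b e (m + 2) a"
      using e by (auto simp: ac(1) grid_cell_def mem_box_cart N'_def)
    have "(\<Prod>j\<in>UNIV. (2::real) powi N' j) \<le> (\<Prod>j\<in>UNIV. 2 powi \<lceil>2 * b j\<rceil> * 2 powi N j)"
    proof (intro prod_mono conjI)
      fix j
      have "(2::real) powi N' j \<le> 2 powi (\<lceil>2 * b j\<rceil> + N j)"
        using N'N[of j] by (intro power_int_increasing) auto
      then show "(2::real) powi N' j \<le> 2 powi \<lceil>2 * b j\<rceil> * 2 powi N j"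
        by (simp add: power_int_add)
    qed simp
    then have "ennreal (\<Prod>j\<in>UNIV. 2 powi N' j) \<le> ennreal ((\<Prod>j\<in>UNIV. 2 powi \<lceil>2 * b j\<rceil>) * (\<Prod>j\<in>UNIV. 2 powi N j))"
      unfolding prod.distrib by (rule ennreal_leI)
    also have "\<dots> = ennreal (\<Prod>j\<in>UNIV. 2 powi \<lceil>2 * b j\<rceil>) * emeasure lebesgue S"
      using emeasure_delta_cube[OF ac(2)] by (simp add: ac(1) N_def prod_nonneg ennreal_mult')
    finally show "emeasure lebesgue C \<le> ennreal (\<Prod>j\<in>UNIV. 2 powi \<lceil>2 * b j\<rceil>) * emeasure lebesgue S"
      unfolding C(4) .
  qed
qed

section \<open>Weighted bound for sparse forms\<close>

lemma sigma_finite_lebesgue: "sigma_finite_measure (lebesgue :: 'a::euclidean_space measure)"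
proof -
  obtain A :: "'a set set" where A: "countable A" "A \<subseteq> sets lborel" "\<Union>A = space lborel" "\<forall>a\<in>A. emeasure lborel a \<noteq> \<infinity>"
    using lborel.sigma_finite_countable by blast
  show ?thesis
    by (rule sigma_finite_measure.intro, intro exI[of _ A]) (use A in auto)
qed

lemma delta_cube_measure:
  fixes b :: "'n::finite \<Rightarrow> real"
  assumes "C \<in> delta_cubes b"
  shows "compact C" "0 < measure lebesgue C" "emeasure lebesgue C = ennreal (measure lebesgue C)"
proof -
  obtain a c m where C: "C = cbox a c" "\<And>j. c $ j - a $ j = 2 powi \<lceil>of_int m * b j\<rceil>"
    using assms by (auto simp: delta_cubes_def)
  have "emeasure lebesgue C = ennreal (\<Prod>j\<in>UNIV. 2 powi \<lceil>of_int m * b j\<rceil>)"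
    unfolding C(1) by (rule emeasure_delta_cube[OF C(2)])
  moreover have "0 < (\<Prod>j\<in>(UNIV::'n set). (2::real) powi \<lceil>of_int m * b j\<rceil>)" by (intro prod_pos) simp
  ultimately show "0 < measure lebesgue C" "emeasure lebesgue C = ennreal (measure lebesgue C)"
    by (simp_all add: measure_def)
  show "compact C" using C by simp
qed

lemma nn_set_integral_pos:
  fixes h :: "'a \<Rightarrow> real"
  assumes [measurable]: "h \<in> borel_measurable M" "C \<in> sets M" and "\<And>x. 0 < h x" "emeasure M C \<noteq> 0"
  shows "(\<integral>\<^sup>+x\<in>C. ennreal (h x) \<partial>M) \<noteq> 0"
proof
  assume "(\<integral>\<^sup>+x\<in>C. ennreal (h x) \<partial>M) = 0"
  then have "AE x in M. x \<notin> C"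
    using assms(3) by (subst (asm) nn_integral_0_iff_AE) (auto simp: less_le indicator_def not_le split: if_splits)
  then show False using assms(4) AE_iff_measurable[OF assms(2), of "\<lambda>x. x \<notin> C"] sets.sets_into_space[OF assms(2)] by auto
qed

lemma avg_eq_ennreal:
  assumes "0 < v" "emeasure lebesgue C = ennreal v" "(\<integral>\<^sup>+x\<in>C. ennreal (h x) \<partial>lebesgue) = ennreal z" "0 \<le> z"
  shows "avg h C = ennreal (z / v)"
  using assms by (simp add: avg_def divide_ennreal)

text \<open>The conjugate exponents identify the averages inside the two constants: 1 - (r/p)' =
  -p/(r-p) belongs to \<sigma> and (q/r)' = q/(q-r) to \<tau>. Cancelling the average of \<omega> is
  legitimate because it is finite, by local integrability, and nonzero, by positivity.\<close>

lemma weight_avg_product: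
  fixes b :: "'n::finite \<Rightarrow> real" and p q r :: real
  assumes pqr: "1 \<le> p" "p < r" "r < q"
    and \<omega>: "\<omega> \<in> A_class b (r / p)" "\<omega> \<in> RH_class b (conj_exp (q / r))"
    and C: "C \<in> delta_cubes b"
  obtains a c where "0 < a" "0 < c"
    "(\<integral>\<^sup>+x\<in>C. ennreal (\<omega> x powr (- p / (r - p))) \<partial>lebesgue) = ennreal (measure lebesgue C * a)"
    "(\<integral>\<^sup>+x\<in>C. ennreal (\<omega> x powr (q / (q - r))) \<partial>lebesgue) = ennreal (measure lebesgue C * c)"
    "a powr ((r - p) / p) * c powr ((q - r) / q)
       \<le> enn2real (A_const b (r / p) \<omega> * RH_const b (conj_exp (q / r)) \<omega>)"
proof -
  define \<sigma> where "\<sigma> x = \<omega> x powr (- p / (r - p))" for x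
  define \<tau> where "\<tau> x = \<omega> x powr (q / (q - r))" for x
  define v where "v = measure lebesgue C"
  note Cm = delta_cube_measure[OF C, folded v_def]
  have pos: "0 < p" "0 < q" "0 < r" "0 < r - p" "0 < q - r" using pqr by auto
  have ex: "1 - conj_exp (r / p) = - p / (r - p)" "r / p - 1 = (r - p) / p"
    "conj_exp (q / r) = q / (q - r)" "1 / (q / (q - r)) = (q - r) / q" "0 < q / (q - r)"
    using pos by (simp_all add: conj_exp_def field_simps)
  have \<omega>m[measurable]: "\<omega> \<in> borel_measurable lebesgue" and \<omega>0: "\<And>x. 0 < \<omega> x"
    and \<omega>i: "\<And>K. compact K \<Longrightarrow> set_integrable lebesgue K \<omega>"
    using \<omega>(1) by (auto simp: A_class_def weight_def)
  have [measurable]: "C \<in> sets lebesgue" using Cm(1) by (simp add: borel_compact)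
  have [measurable]: "\<sigma> \<in> borel_measurable lebesgue" "\<tau> \<in> borel_measurable lebesgue"
    unfolding \<sigma>_def \<tau>_def by measurable
  have \<sigma>0: "0 < \<sigma> x" and \<tau>0: "0 < \<tau> x" for x using \<omega>0[of x] by (auto simp: \<sigma>_def \<tau>_def)
  have avg0: "avg h C \<noteq> 0" if [measurable]: "h \<in> borel_measurable lebesgue" and "\<And>x. 0 < h x" for h
    using nn_set_integral_pos[of h lebesgue C] that Cm by (simp add: avg_def ennreal_divide_eq_0_iff)
  have int_eq: "(\<integral>\<^sup>+x\<in>C. ennreal (h x) \<partial>lebesgue) = ennreal (v * z)" if "avg h C = ennreal z" "0 \<le> z" for h z
  proof -
    have "(\<integral>\<^sup>+x\<in>C. ennreal (h x) \<partial>lebesgue) = avg h C * ennreal v"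
      using Cm(2) by (simp add: avg_def Cm(3) ennreal_divide_times)
    then show ?thesis using that Cm(2) by (simp add: mult.commute ennreal_mult)
  qed
  have "(\<integral>\<^sup>+x\<in>C. ennreal (\<omega> x) \<partial>lebesgue) = (\<integral>\<^sup>+x. ennreal (norm (indicator C x *\<^sub>R \<omega> x)) \<partial>lebesgue)"
    using \<omega>0 by (intro nn_integral_cong) (auto simp: less_imp_le split: split_indicator)
  also have "\<dots> < \<infinity>"
    using \<omega>i[OF Cm(1)] by (simp add: set_integrable_def integrable_iff_bounded)
  finally have "avg \<omega> C < \<infinity>"
    using Cm(2,3) by (simp add: avg_def ennreal_divide_eq_top_iff less_top[symmetric])
  then obtain z where z: "avg \<omega> C = ennreal z" "0 < z"
    using avg0[OF \<omega>m \<omega>0] by (cases "avg \<omega> C") (auto simp: less_le)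
  have Ale: "ennreal z * epowr (avg \<sigma> C) ((r - p) / p) \<le> A_const b (r / p) \<omega>"
    unfolding A_const_def ex z(1)[symmetric] \<sigma>_def by (rule SUP_upper[OF C])
  have Afin: "A_const b (r / p) \<omega> < top" using \<omega>(1) by (simp add: A_class_def)
  \<comment> \<open>Finiteness of the averages of \<sigma> and, below, of \<tau> is not assumed. It
    follows from that of the weight constants, since the factors \<open>z\<close> and
    \<open>inverse z\<close> in front are nonzero.\<close>
  have "avg \<sigma> C \<noteq> top"
    using Ale Afin z(2) by (auto simp: epowr_def ennreal_mult_top top_unique)
  then obtain a where a: "avg \<sigma> C = ennreal a" "0 < a"
    using avg0[of \<sigma>] \<sigma>0 by (cases "avg \<sigma> C") (auto simp: less_le)
  have "p_avg (ennreal (q / (q - r))) \<omega> C = epowr (avg \<tau> C) ((q - r) / q)"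
    using \<omega>0 ex(5) unfolding p_avg_def \<tau>_def by (simp add: less_imp_le)
  moreover have "inverse (avg \<omega> C) = ennreal (inverse z)" using z by (simp add: inverse_ennreal)
  ultimately have Rle: "ennreal (inverse z) * epowr (avg \<tau> C) ((q - r) / q) \<le> RH_const b (conj_exp (q / r)) \<omega>"
    unfolding RH_const_def ex by (metis (mono_tags, lifting) SUP_upper[OF C])
  have Rfin: "RH_const b (conj_exp (q / r)) \<omega> < top" using \<omega>(2) by (simp add: RH_class_def)
  have "avg \<tau> C \<noteq> top"
    using Rle Rfin z(2) by (auto simp: epowr_def ennreal_mult_top top_unique)
  then obtain c where c: "avg \<tau> C = ennreal c" "0 < c"
    using avg0[of \<tau>] \<tau>0 by (cases "avg \<tau> C") (auto simp: less_le)
  have "ennreal (a powr ((r - p) / p) * c powr ((q - r) / q))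
     = (ennreal z * epowr (avg \<sigma> C) ((r - p) / p)) * (ennreal (inverse z) * epowr (avg \<tau> C) ((q - r) / q))"
    using z a c by (simp add: epowr_def flip: ennreal_mult)
  also have "\<dots> \<le> A_const b (r / p) \<omega> * RH_const b (conj_exp (q / r)) \<omega>"
    by (intro mult_mono Ale Rle) auto
  also have "\<dots> = ennreal (enn2real (A_const b (r / p) \<omega> * RH_const b (conj_exp (q / r)) \<omega>))"
    using Afin Rfin by (simp add: ennreal_mult_less_top)
  finally have "a powr ((r - p) / p) * c powr ((q - r) / q) \<le> enn2real (A_const b (r / p) \<omega> * RH_const b (conj_exp (q / r)) \<omega>)"
    by (subst (asm) ennreal_le_iff) auto
  with a(2) c(2) int_eq[OF a(1)] int_eq[OF c(1)] show ?thesis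
    unfolding \<sigma>_def \<tau>_def v_def by (intro that) auto
qed

text \<open>Enlarging the cube costs the factor \<open>\<kappa> powr (1 / p)\<close>; it is rounded
  up to \<kappa>, so that the same constant serves for every exponent.\<close>

lemma p_avg_le:
  fixes f :: "real ^ 'n::finite \<Rightarrow> 'a::real_normed_vector" and p \<kappa> :: real
  assumes p: "1 \<le> p" and \<kappa>: "1 \<le> \<kappa>" and "S \<subseteq> C"
    and S: "0 < measure lebesgue S" "emeasure lebesgue S = ennreal (measure lebesgue S)"
    and C: "measure lebesgue C \<le> \<kappa> * measure lebesgue S" "0 < measure lebesgue C"
    and int: "(\<integral>\<^sup>+x\<in>C. ennreal (norm (f x) powr p) \<partial>lebesgue) = ennreal (measure lebesgue C * z)" "0 \<le> z"
  shows "p_avg (ennreal p) f S \<le> ennreal (\<kappa> * z powr (1 / p))"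
proof -
  define vS where "vS = measure lebesgue S"
  define vC where "vC = measure lebesgue C"
  have "(\<integral>\<^sup>+x\<in>S. ennreal (norm (f x) powr p) \<partial>lebesgue) \<le> ennreal (vC * z)"
    unfolding int(1)[symmetric] vC_def using \<open>S \<subseteq> C\<close> by (intro nn_integral_mono) (auto split: split_indicator)
  then obtain y where y: "(\<integral>\<^sup>+x\<in>S. ennreal (norm (f x) powr p) \<partial>lebesgue) = ennreal y" "0 \<le> y" "y \<le> vC * z"
    using C int(2) by (cases "\<integral>\<^sup>+x\<in>S. ennreal (norm (f x) powr p) \<partial>lebesgue") (auto simp: vC_def top_unique)
  have "p_avg (ennreal p) f S = epowr (avg (\<lambda>x. norm (f x) powr p) S) (1 / p)"
    using p by (simp add: p_avg_def)
  also have "avg (\<lambda>x. norm (f x) powr p) S = ennreal (y / vS)"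
    using S y unfolding vS_def by (intro avg_eq_ennreal) auto
  also have "epowr (ennreal (y / vS)) (1 / p) = ennreal ((y / vS) powr (1 / p))"
    using y S by (simp add: epowr_def vS_def)
  also have "(y / vS) powr (1 / p) \<le> (\<kappa> * z) powr (1 / p)"
  proof -
    have "y \<le> \<kappa> * vS * z"
      using y(3) C int(2) by (auto simp: vS_def vC_def intro: order_trans mult_right_mono)
    then show ?thesis using p y S by (intro powr_mono2) (auto simp: vS_def pos_divide_le_eq mult_ac)
  qed
  also have "\<dots> \<le> \<kappa> * z powr (1 / p)"
  proof -
    have "\<kappa> powr (1 / p) \<le> \<kappa> powr 1" using \<kappa> p by (intro powr_mono) auto
    then show ?thesis using \<kappa> by (simp add: powr_mult mult_right_mono)
  qed
  finally show ?thesis by (simp add: ennreal_leI)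
qed

text \<open>The function \<open>h\<close> will be the constant 1, for the averages in the sparse
  form, or the weight, for the norm of f.\<close>

lemma bounded_cpt_supp_powr:
  fixes f :: "real ^ 'n::finite \<Rightarrow> complex"
  assumes f: "bounded_cpt_supp f"
  shows "(\<lambda>x. norm (f x) powr s) \<in> borel_measurable lebesgue"
    and "\<And>h :: real ^ 'n \<Rightarrow> real. 0 < s \<Longrightarrow> h \<in> borel_measurable lebesgue \<Longrightarrow> (\<And>x. 0 \<le> h x) \<Longrightarrow>
      (\<And>K. compact K \<Longrightarrow> set_integrable lebesgue K h) \<Longrightarrow>
      (\<integral>\<^sup>+x. ennreal (norm (f x) powr s * h x) \<partial>lebesgue) < \<infinity>"
proof -
  have [measurable]: "f \<in> borel_measurable borel" using f by (simp add: bounded_cpt_supp_def)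
  have fl: "f \<in> borel_measurable lebesgue" by (rule measurable_completion) simp
  then show "(\<lambda>x. norm (f x) powr s) \<in> borel_measurable lebesgue" by measurable
  fix h :: "real ^ 'n \<Rightarrow> real"
  assume s: "0 < s" and [measurable]: "h \<in> borel_measurable lebesgue" and h0: "\<And>x. 0 \<le> h x"
    and h: "\<And>K. compact K \<Longrightarrow> set_integrable lebesgue K h"
  define K where "K = closure {x. f x \<noteq> 0}"
  have K: "compact K" using f by (simp add: bounded_cpt_supp_def K_def)
  obtain R where R: "\<And>x. norm (f x) \<le> R" using f by (auto simp: bounded_cpt_supp_def bounded_iff)
  have "(\<integral>\<^sup>+x. ennreal (norm (f x) powr s * h x) \<partial>lebesgue)
     \<le> (\<integral>\<^sup>+x. ennreal (R powr s) * ennreal (norm (indicator K x *\<^sub>R h x)) \<partial>lebesgue)"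
  proof (rule nn_integral_mono)
    fix x
    show "ennreal (norm (f x) powr s * h x) \<le> ennreal (R powr s) * ennreal (norm (indicator K x *\<^sub>R h x))"
    proof (cases "f x = 0")
      case False
      then have "x \<in> K" unfolding K_def using closure_subset by fast
      moreover have "norm (f x) powr s * h x \<le> R powr s * h x"
        using R s h0 by (intro mult_right_mono powr_mono2) auto
      ultimately show ?thesis using h0 by (simp add: ennreal_leI flip: ennreal_mult')
    qed simp
  qed
  also have "\<dots> = ennreal (R powr s) * (\<integral>\<^sup>+x. ennreal (norm (indicator K x *\<^sub>R h x)) \<partial>lebesgue)"
  proof (rule nn_integral_cmult)
    have [measurable]: "K \<in> sets lebesgue" using K by (simp add: borel_compact)
    show "(\<lambda>x. ennreal (norm (indicator K x *\<^sub>R h x))) \<in> borel_measurable lebesgue" by measurable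
  qed
  also have "\<dots> < \<infinity>"
    using h[OF K] by (simp add: set_integrable_def integrable_iff_bounded ennreal_mult_less_top)
  finally show "(\<integral>\<^sup>+x. ennreal (norm (f x) powr s * h x) \<partial>lebesgue) < \<infinity>" .
qed

text \<open>The constant \<open>K\<close> is chosen before the weight, the functions and the sparse
  family. This order of quantifiers carries the uniformity claimed in the end, including that of the
  supremum over sparse families.\<close>

lemma sparse_form_le:
  fixes b :: "'n::finite \<Rightarrow> real" and p q r :: real
  assumes b: "\<And>j. b j \<ge> 1" and pqr: "1 \<le> p" "p < r" "r < q"
  obtains K where "0 \<le> K"
    "\<And>\<omega> f g \<S> A B. \<omega> \<in> A_class b (r / p) \<Longrightarrow> \<omega> \<in> RH_class b (conj_exp (q / r)) \<Longrightarrow>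
      bounded_cpt_supp f \<Longrightarrow> bounded_cpt_supp g \<Longrightarrow> sparse b \<S> \<Longrightarrow> 0 \<le> A \<Longrightarrow> 0 \<le> B \<Longrightarrow>
      (\<integral>\<^sup>+x. ennreal (norm (f x) powr r * \<omega> x) \<partial>lebesgue) = ennreal A \<Longrightarrow>
      (\<integral>\<^sup>+x. ennreal (norm (g x) powr (r / (r - 1)) * \<omega> x powr (- 1 / (r - 1))) \<partial>lebesgue) = ennreal B \<Longrightarrow>
      sparse_form \<S> (ennreal p) (ennreal (q / (q - 1))) f g
        \<le> ennreal (K * enn2real (A_const b (r / p) \<omega> * RH_const b (conj_exp (q / r)) \<omega>)
             powr max (1 / (r - p)) ((q - 1) / (q - r)) * A powr (1 / r) * B powr ((r - 1) / r))"
proof -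
  define \<kappa> :: real where "\<kappa> = (\<Prod>j\<in>UNIV. 2 powi \<lceil>2 * b j\<rceil>)"
  have \<kappa>: "1 \<le> \<kappa>"
    unfolding \<kappa>_def
  proof (rule prod_ge_1)
    fix j
    have "0 \<le> \<lceil>2 * b j\<rceil>" using b[of j] by linarith
    then show "1 \<le> (2::real) powi \<lceil>2 * b j\<rceil>" by (simp add: one_le_power_int)
  qed
  define d where "d = (r - p) / p + (q - r) / q"
  define K1 where "K1 s = 4 powr s / (s - 1)" for s :: real
  \<comment> \<open>The constant of the laminar bound for sets \<open>E S\<close> of relative size
    \<open>1 / (4 * \<kappa>)\<close>: a quarter from sparseness, and \<kappa> from the enlargement
    of the cube.\<close>
  define H where "H = (1 / (1 / (4 * \<kappa>)) powr d) powr max (p / (r * (r - p))) (q * (r - 1) / (r * (q - r)))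
       * K1 (r / p) powr (1 / r) * K1 (r * (q - 1) / ((r - 1) * q)) powr ((r - 1) / r)"
  have H0: "0 \<le> H" by (simp add: H_def)
  define q' where "q' = q / (q - 1)"
  have pos: "0 < p" "0 < q" "0 < r" "0 < r - p" "0 < q - r" "0 < r - 1" "0 < q - 1" using pqr by auto
  have q': "1 \<le> q'" "1 / q' = (q - 1) / q" using pos by (simp_all add: q'_def field_simps)
  show ?thesis
  \<comment> \<open>Each of the two averages contributes one \<kappa> when it is moved to the larger
    cube; the cardinality counts the grids.\<close>
  proof (rule that[of "\<kappa> * \<kappa> * (real (card (UNIV :: ('n \<Rightarrow> bool) set)) * H)"])
    show "0 \<le> \<kappa> * \<kappa> * (real (card (UNIV :: ('n \<Rightarrow> bool) set)) * H)" using \<kappa> H0 by simp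
  next
    fix \<omega> :: "real ^ 'n \<Rightarrow> real" and f g :: "real ^ 'n \<Rightarrow> complex" and \<S> A B
    assume \<omega>: "\<omega> \<in> A_class b (r / p)" "\<omega> \<in> RH_class b (conj_exp (q / r))"
      and f: "bounded_cpt_supp f" and g: "bounded_cpt_supp g" and sp: "sparse b \<S>"
      and AB: "0 \<le> A" "0 \<le> B"
      and A: "(\<integral>\<^sup>+x. ennreal (norm (f x) powr r * \<omega> x) \<partial>lebesgue) = ennreal A"
      and B: "(\<integral>\<^sup>+x. ennreal (norm (g x) powr (r / (r - 1)) * \<omega> x powr (- 1 / (r - 1))) \<partial>lebesgue) = ennreal B"
    define Y where "Y = enn2real (A_const b (r / p) \<omega> * RH_const b (conj_exp (q / r)) \<omega>)"
    define \<sigma> where "\<sigma> x = \<omega> x powr (- p / (r - p))" for x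
    define \<tau> where "\<tau> x = \<omega> x powr (q / (q - r))" for x
    define F where "F x = norm (f x) powr p" for x
    define G where "G x = norm (g x) powr q'" for x
    define Bd where "Bd = H * Y powr max (1 / (r - p)) ((q - 1) / (q - r)) * A powr (1 / r) * B powr ((r - 1) / r)"
    have \<omega>m[measurable]: "\<omega> \<in> borel_measurable lebesgue" and \<omega>0: "\<And>x. 0 < \<omega> x"
      using \<omega>(1) by (auto simp: A_class_def weight_def)
    have \<sigma>m: "\<sigma> \<in> borel_measurable lebesgue" and \<tau>m: "\<tau> \<in> borel_measurable lebesgue"
      unfolding \<sigma>_def \<tau>_def by measurable
    have \<sigma>0: "0 < \<sigma> x" and \<tau>0: "0 < \<tau> x" for x using \<omega>0[of x] by (auto simp: \<sigma>_def \<tau>_def)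
    have dual: "\<sigma> x powr ((r - p) / p) * \<tau> x powr ((q - r) / q) = 1" for x
    proof -
      have "\<sigma> x powr ((r - p) / p) = \<omega> x powr (- 1)" "\<tau> x powr ((q - r) / q) = \<omega> x powr 1"
        using pos by (simp_all add: \<sigma>_def \<tau>_def powr_powr)
      then show ?thesis using \<omega>0[of x] by (simp flip: powr_add)
    qed
    have Fm: "F \<in> borel_measurable lebesgue" and Gm: "G \<in> borel_measurable lebesgue"
      unfolding F_def[abs_def] G_def[abs_def] by (rule bounded_cpt_supp_powr(1); fact)+
    have F0: "0 \<le> F x" and G0: "0 \<le> G x" for x by (auto simp: F_def G_def)
    have one: "set_integrable lebesgue K (\<lambda>x. 1 :: real)" if "compact K" for K :: "(real ^ 'n) set"
      using lmeasurable_compact[OF that]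
      by (auto simp: set_integrable_def fmeasurable_def intro!: integrable_real_indicator)
    have Fint: "(\<integral>\<^sup>+x. ennreal (F x) \<partial>lebesgue) < \<infinity>" and Gint: "(\<integral>\<^sup>+x. ennreal (G x) \<partial>lebesgue) < \<infinity>"
      using bounded_cpt_supp_powr(2)[OF f, of p "\<lambda>x. 1"] bounded_cpt_supp_powr(2)[OF g, of q' "\<lambda>x. 1"] one pos q'
      by (auto simp: F_def G_def)
    have A': "(\<integral>\<^sup>+x. ennreal (F x powr (r / p) * \<sigma> x powr (1 - r / p)) \<partial>lebesgue) = ennreal A"
    proof -
      have "\<sigma> x powr (1 - r / p) = \<omega> x" for x
      proof -
        have "\<sigma> x powr (1 - r / p) = \<omega> x powr ((- p / (r - p)) * (1 - r / p))"
          by (simp only: \<sigma>_def powr_powr)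
        also have "(- p / (r - p)) * (1 - r / p) = 1" using pos by (simp add: field_simps)
        finally show ?thesis using \<omega>0[of x] by simp
      qed
      moreover have "F x powr (r / p) = norm (f x) powr r" for x
        using pos by (simp add: F_def powr_powr)
      ultimately show ?thesis using A by simp
    qed
    have B': "(\<integral>\<^sup>+x. ennreal (G x powr (r * (q - 1) / ((r - 1) * q)) 
              * \<tau> x powr (1 - r * (q - 1) / ((r - 1) * q))) \<partial>lebesgue) = ennreal B"
    proof -
      have "\<tau> x powr (1 - r * (q - 1) / ((r - 1) * q)) = \<omega> x powr (- 1 / (r - 1))" for x
      proof -
        have "\<tau> x powr (1 - r * (q - 1) / ((r - 1) * q)) = \<omega> x powr (q / (q - r) * (1 - r * (q - 1) / ((r - 1) * q)))"
          by (simp only: \<tau>_def powr_powr)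
        also have "q / (q - r) * (1 - r * (q - 1) / ((r - 1) * q)) = - 1 / (r - 1)"
        proof -
          have "1 - r * (q - 1) / ((r - 1) * q) = - (q - r) / ((r - 1) * q)"
            using pos by (simp add: field_simps)
          then show ?thesis using pos by (simp add: divide_simps)
        qed
        finally show ?thesis .
      qed
      moreover have "G x powr (r * (q - 1) / ((r - 1) * q)) = norm (g x) powr (r / (r - 1))" for x
      proof -
        have "G x powr (r * (q - 1) / ((r - 1) * q)) = norm (g x) powr (q' * (r * (q - 1) / ((r - 1) * q)))"
          by (simp only: G_def powr_powr)
        also have "q' * (r * (q - 1) / ((r - 1) * q)) = r / (r - 1)"
          using pos by (simp add: q'_def divide_simps)
        finally show ?thesis .
      qed
      ultimately show ?thesis using B by simp
    qed
    have sub: "\<S> \<subseteq> delta_cubes b" using sp by (simp add: sparse_def)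
    obtain E where E: "disjoint_family_on E \<S>" 
      and E': "\<And>S. S \<in> \<S> \<Longrightarrow> E S \<in> sets lebesgue" "\<And>S. S \<in> \<S> \<Longrightarrow> E S \<subseteq> S"
        "\<And>S. S \<in> \<S> \<Longrightarrow> measure lebesgue (E S) > 1/4 * measure lebesgue S"
      using sp unfolding sparse_def by blast
    have "\<forall>S\<in>\<S>. \<exists>e Q C. Q \<in> delta_grid b e \<and> S \<subseteq> Q \<and> C \<in> delta_cubes b \<and> Q \<subseteq> C \<and> C - Q \<in> null_sets lebesgue \<and>
      emeasure lebesgue C \<le> ennreal \<kappa> * emeasure lebesgue S"
    proof
      fix S assume "S \<in> \<S>"
      then have "S \<in> delta_cubes b" using sub by blast
      from delta_cube_grid_cover[OF b this]
      show "\<exists>e Q C. Q \<in> delta_grid b e \<and> S \<subseteq> Q \<and> C \<in> delta_cubes b \<and> Q \<subseteq> C \<and> C - Q \<in> null_sets lebesgue \<and>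
         emeasure lebesgue C \<le> ennreal \<kappa> * emeasure lebesgue S"
        unfolding \<kappa>_def by metis
    qed
    from bchoice[OF this] obtain e where "\<forall>S\<in>\<S>. \<exists>Q C. Q \<in> delta_grid b (e S) \<and> S \<subseteq> Q \<and> C \<in> delta_cubes b \<and> Q \<subseteq> C \<and> C - Q \<in> null_sets lebesgue \<and>
      emeasure lebesgue (C) \<le> ennreal \<kappa> * emeasure lebesgue S" ..
    from bchoice[OF this] obtain Q where "\<forall>S\<in>\<S>. \<exists>C. Q S \<in> delta_grid b (e S) \<and> S \<subseteq> Q S \<and> C \<in> delta_cubes b \<and> Q S \<subseteq> C \<and> C - Q S \<in> null_sets lebesgue \<and>
      emeasure lebesgue (C) \<le> ennreal \<kappa> * emeasure lebesgue S" ..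
    from bchoice[OF this] obtain C where "\<forall>S\<in>\<S>. Q S \<in> delta_grid b (e S) \<and> S \<subseteq> Q S \<and> C S \<in> delta_cubes b \<and> Q S \<subseteq> C S \<and> C S - Q S \<in> null_sets lebesgue \<and>
      emeasure lebesgue (C S) \<le> ennreal \<kappa> * emeasure lebesgue S" ..
    then have QC: "\<And>S. S \<in> \<S> \<Longrightarrow> Q S \<in> delta_grid b (e S)" "\<And>S. S \<in> \<S> \<Longrightarrow> S \<subseteq> Q S"
        "\<And>S. S \<in> \<S> \<Longrightarrow> C S \<in> delta_cubes b" "\<And>S. S \<in> \<S> \<Longrightarrow> Q S \<subseteq> C S"
        "\<And>S. S \<in> \<S> \<Longrightarrow> C S - Q S \<in> null_sets lebesgue"
        "\<And>S. S \<in> \<S> \<Longrightarrow> emeasure lebesgue (C S) \<le> ennreal \<kappa> * emeasure lebesgue S"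
      by simp_all
    define w where "w S = measure lebesgue (C S)" for S
    have Sd: "S \<in> delta_cubes b" if "S \<in> \<S>" for S using that sub by blast
    note Sm = delta_cube_measure[OF Sd] and Cm = delta_cube_measure[OF QC(3), folded w_def]
    have wS: "w S \<le> \<kappa> * measure lebesgue S" "measure lebesgue S \<le> w S" if S: "S \<in> \<S>" for S
    proof -
      have "ennreal (w S) \<le> ennreal (\<kappa> * measure lebesgue S)"
        using QC(6)[OF S] Sm(3)[OF S] Cm(3)[OF S] \<kappa> by (simp add: ennreal_mult')
      then show "w S \<le> \<kappa> * measure lebesgue S" using \<kappa> Sm(2)[OF S] by (subst (asm) ennreal_le_iff) auto
      have "emeasure lebesgue S \<le> emeasure lebesgue (C S)"
        using QC(2,4)[OF S] Cm(1)[OF S] by (intro emeasure_mono) (auto simp: borel_compact)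
      then show "measure lebesgue S \<le> w S"
        using Sm(3)[OF S] Cm(2,3)[OF S] by (simp add: ennreal_le_iff less_imp_le)
    qed
    have Qm: "Q S \<in> sets lebesgue" if S: "S \<in> \<S>" for S
    proof -
      have "C S - (C S - Q S) \<in> sets lebesgue"
        using Cm(1)[OF S] by (intro sets.Diff null_setsD2[OF QC(5)[OF S]]) (simp add: borel_compact)
      moreover have "C S - (C S - Q S) = Q S" using QC(4)[OF S] by blast
      ultimately show ?thesis by simp
    qed
    \<comment> \<open>The laminar estimate works on the cells, the weight constants on their
      closures; integrals do not distinguish them.\<close>
    have QCint: "(\<integral>\<^sup>+x\<in>Q S. h x \<partial>lebesgue) = (\<integral>\<^sup>+x\<in>C S. h x \<partial>lebesgue)" if S: "S \<in> \<S>" for S h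
    proof (rule nn_integral_null_delta)
      have "Q S - C S \<union> (C S - Q S) = C S - Q S" using QC(4)[OF S] by blast
      then show "Q S - C S \<union> (C S - Q S) \<in> null_sets lebesgue" using QC(5)[OF S] by simp
    qed (use Qm[OF S] Cm(1)[OF S] in \<open>auto simp: borel_compact\<close>)
    define av where "av h S = enn2real (\<integral>\<^sup>+x\<in>C S. ennreal (h x) \<partial>lebesgue) / w S" for h :: "real ^ 'n \<Rightarrow> real" and S
    have av: "(\<integral>\<^sup>+x\<in>C S. ennreal (h x) \<partial>lebesgue) = ennreal (w S * av h S)" "0 \<le> av h S"
      if S: "S \<in> \<S>" and h: "(\<integral>\<^sup>+x. ennreal (h x) \<partial>lebesgue) < \<infinity>" for h S
    proof -
      have "(\<integral>\<^sup>+x\<in>C S. ennreal (h x) \<partial>lebesgue) \<le> (\<integral>\<^sup>+x. ennreal (h x) \<partial>lebesgue)"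
        by (intro nn_integral_mono) (auto split: split_indicator)
      then show "(\<integral>\<^sup>+x\<in>C S. ennreal (h x) \<partial>lebesgue) = ennreal (w S * av h S)"
        using h Cm(2)[OF S] by (simp add: av_def less_top)
      show "0 \<le> av h S" using Cm(2)[OF S] by (simp add: av_def)
    qed
    have "\<forall>S\<in>\<S>. \<exists>a c. 0 < a \<and> 0 < c \<and>
        (\<integral>\<^sup>+x\<in>C S. ennreal (\<sigma> x) \<partial>lebesgue) = ennreal (w S * a) \<and>
        (\<integral>\<^sup>+x\<in>C S. ennreal (\<tau> x) \<partial>lebesgue) = ennreal (w S * c) \<and>
        a powr ((r - p) / p) * c powr ((q - r) / q) \<le> Y"
    proof
      fix S assume S: "S \<in> \<S>"
      show "\<exists>a c. 0 < a \<and> 0 < c \<and>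
        (\<integral>\<^sup>+x\<in>C S. ennreal (\<sigma> x) \<partial>lebesgue) = ennreal (w S * a) \<and>
        (\<integral>\<^sup>+x\<in>C S. ennreal (\<tau> x) \<partial>lebesgue) = ennreal (w S * c) \<and>
        a powr ((r - p) / p) * c powr ((q - r) / q) \<le> Y"
        unfolding \<sigma>_def \<tau>_def w_def Y_def by (rule weight_avg_product[OF pqr \<omega> QC(3)[OF S]]) blast
    qed
    from bchoice[OF this] obtain a where "\<forall>S\<in>\<S>. \<exists>c. 0 < a S \<and> 0 < c \<and>
        (\<integral>\<^sup>+x\<in>C S. ennreal (\<sigma> x) \<partial>lebesgue) = ennreal (w S * a S) \<and>
        (\<integral>\<^sup>+x\<in>C S. ennreal (\<tau> x) \<partial>lebesgue) = ennreal (w S * c) \<and>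
        a S powr ((r - p) / p) * c powr ((q - r) / q) \<le> Y" ..
    from bchoice[OF this] obtain c where "\<forall>S\<in>\<S>. 0 < a S \<and> 0 < c S \<and>
        (\<integral>\<^sup>+x\<in>C S. ennreal (\<sigma> x) \<partial>lebesgue) = ennreal (w S * a S) \<and>
        (\<integral>\<^sup>+x\<in>C S. ennreal (\<tau> x) \<partial>lebesgue) = ennreal (w S * c S) \<and>
        a S powr ((r - p) / p) * c S powr ((q - r) / q) \<le> Y" ..
    then have ac: "\<And>S. S \<in> \<S> \<Longrightarrow> 0 < a S" "\<And>S. S \<in> \<S> \<Longrightarrow> 0 < c S"
        "\<And>S. S \<in> \<S> \<Longrightarrow> (\<integral>\<^sup>+x\<in>C S. ennreal (\<sigma> x) \<partial>lebesgue) = ennreal (w S * a S)"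
        "\<And>S. S \<in> \<S> \<Longrightarrow> (\<integral>\<^sup>+x\<in>C S. ennreal (\<tau> x) \<partial>lebesgue) = ennreal (w S * c S)"
        "\<And>S. S \<in> \<S> \<Longrightarrow> a S powr ((r - p) / p) * c S powr ((q - r) / q) \<le> Y"
      by simp_all
    define t where "t S = w S * av F S powr (1 / p) * av G S powr ((q - 1) / q)" for S
    have t0: "0 \<le> t S" if "S \<in> \<S>" for S using Cm(2)[OF that] by (simp add: t_def)
    have term_le: "emeasure lebesgue S * p_avg (ennreal p) f S * p_avg (ennreal q') g S \<le> ennreal (\<kappa> * \<kappa> * t S)"
      if S: "S \<in> \<S>" for S
    proof -
      have SC: "S \<subseteq> C S" using QC(2,4)[OF S] by blast
      have "p_avg (ennreal p) f S \<le> ennreal (\<kappa> * av F S powr (1 / p))"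
        using av[OF S Fint] wS[OF S] unfolding F_def w_def
        by (intro p_avg_le[OF pqr(1) \<kappa> SC Sm(2,3)[OF S] _ Cm(2)[OF S, unfolded w_def]]) auto
      moreover have "p_avg (ennreal q') g S \<le> ennreal (\<kappa> * av G S powr ((q - 1) / q))"
        using av[OF S Gint] wS[OF S] unfolding G_def w_def q'(2)[symmetric]
        by (intro p_avg_le[OF q'(1) \<kappa> SC Sm(2,3)[OF S] _ Cm(2)[OF S, unfolded w_def]]) auto
      moreover have "emeasure lebesgue S \<le> ennreal (w S)"
        using Sm(3)[OF S] wS(2)[OF S] by (simp add: ennreal_leI)
      ultimately have "emeasure lebesgue S * p_avg (ennreal p) f S * p_avg (ennreal q') g S
        \<le> ennreal (w S) * ennreal (\<kappa> * av F S powr (1 / p)) * ennreal (\<kappa> * av G S powr ((q - 1) / q))"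
        by (intro mult_mono) auto
      also have "\<dots> = ennreal (w S * (\<kappa> * av F S powr (1 / p)) * (\<kappa> * av G S powr ((q - 1) / q)))"
        using \<kappa> Cm(2)[OF S] by (simp only: ennreal_mult' mult_nonneg_nonneg powr_ge_zero less_imp_le)
      also have "w S * (\<kappa> * av F S powr (1 / p)) * (\<kappa> * av G S powr ((q - 1) / q)) = \<kappa> * \<kappa> * t S"
        by (simp only: t_def mult_ac)
      finally show ?thesis .
    qed
    \<comment> \<open>Cells of different grids need not be nested, so the bound is proved for the
      cubes assigned to one grid and added up over the grids afterwards.\<close>
    have grid: "(\<Sum>S\<in>I. t S) \<le> Bd" if I: "finite I" "I \<subseteq> \<S>" "\<And>S. S \<in> I \<Longrightarrow> e S = e0" for I e0
    proof -
      have IS: "S \<in> \<S>" if "S \<in> I" for S using that I by blast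
      have lam: "laminar (Q ` I)"
        by (rule laminar_subset[OF laminar_delta_grid[OF b, where e = e0]]) (use QC(1)[OF IS] I(3) in auto)
      have disj: "disjoint_family_on E I" using E I(2) by (rule disjoint_family_on_mono[rotated])
      have fat: "ennreal (1 / (4 * \<kappa>) * w S) \<le> emeasure lebesgue (E S)" if "S \<in> I" for S
      proof -
        note S = IS[OF that]
        have "1 / (4 * \<kappa>) * w S \<le> measure lebesgue (E S)"
        proof -
          have "w S \<le> \<kappa> * (4 * measure lebesgue (E S))"
            using E'(3)[OF S] \<kappa> by (intro order_trans[OF wS(1)[OF S]] mult_left_mono) auto
          then show ?thesis using \<kappa> by (simp add: field_simps)
        qed
        moreover have "emeasure lebesgue (E S) \<le> emeasure lebesgue S"
          using E'(2)[OF S] Sm(1)[OF S] by (intro emeasure_mono) (auto simp: borel_compact)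
        then have "emeasure lebesgue (E S) = ennreal (measure lebesgue (E S))"
          using Sm(3)[OF S] by (intro emeasure_eq_ennreal_measure) (auto simp: top_unique)
        ultimately show ?thesis by (simp add: ennreal_leI)
      qed
      have EQ: "E S \<subseteq> Q S" if "S \<in> I" for S using E'(2) QC(2) IS[OF that] by blast
      have \<kappa>pos: "0 < 1 / (4 * \<kappa>)" using \<kappa> by simp
      show ?thesis
        unfolding t_def Bd_def H_def K1_def d_def
        by (rule laminar_sparse_form_bound[OF sigma_finite_lebesgue pqr I(1) lam Qm[OF IS] E'(1)[OF IS] EQ disj \<kappa>pos fat
              Fm F0 Gm G0 \<sigma>m \<sigma>0 \<tau>m \<tau>0 dual Cm(2)[OF IS] ac(1)[OF IS] ac(2)[OF IS] av(2)[OF IS Fint] av(2)[OF IS Gint]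
              trans[OF QCint[OF IS] ac(3)[OF IS]] trans[OF QCint[OF IS] ac(4)[OF IS]]
              trans[OF QCint[OF IS] av(1)[OF IS Fint]] trans[OF QCint[OF IS] av(1)[OF IS Gint]] ac(5)[OF IS] AB A' B'])
    qed
    have "sparse_form \<S> (ennreal p) (ennreal q') f g \<le> ennreal (\<kappa> * \<kappa> * (real (card (UNIV :: ('n \<Rightarrow> bool) set)) * Bd))"
    proof -
      \<comment> \<open>A sum of nonnegative extended reals is the supremum of its finite partial
        sums, which reduces the claim to finite families, as the choice of maximal cells
        requires.\<close>
      have "sparse_form \<S> (ennreal p) (ennreal q') f g 
        = (SUP I\<in>{I. finite I \<and> I \<subseteq> \<S>}. \<Sum>S\<in>I. emeasure lebesgue S * p_avg (ennreal p) f S * p_avg (ennreal q') g S)"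
        unfolding sparse_form_def by (rule nonneg_infsum_complete) simp
      also have "\<dots> \<le> ennreal (\<kappa> * \<kappa> * (real (card (UNIV :: ('n \<Rightarrow> bool) set)) * Bd))"
      proof (rule SUP_least, clarify)
        fix I assume I: "finite I" "I \<subseteq> \<S>"
        have "(\<Sum>S\<in>I. emeasure lebesgue S * p_avg (ennreal p) f S * p_avg (ennreal q') g S) \<le> (\<Sum>S\<in>I. ennreal (\<kappa> * \<kappa> * t S))"
          using I by (intro sum_mono term_le) auto
        also have "\<dots> = ennreal (\<kappa> * \<kappa> * (\<Sum>S\<in>I. t S))"
          using I t0 \<kappa> by (subst sum_ennreal) (auto simp: sum_distrib_left intro!: mult_nonneg_nonneg)
        also have "(\<Sum>S\<in>I. t S) = (\<Sum>e0\<in>UNIV. \<Sum>S | S \<in> I \<and> e S = e0. t S)"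
          using I(1) by (intro sum.group[symmetric]) auto
        also have "\<dots> \<le> (\<Sum>e0\<in>(UNIV :: ('n \<Rightarrow> bool) set). Bd)"
          using I by (intro sum_mono grid) auto
        also have "\<dots> = real (card (UNIV :: ('n \<Rightarrow> bool) set)) * Bd" by simp
        finally show "(\<Sum>S\<in>I. emeasure lebesgue S * p_avg (ennreal p) f S * p_avg (ennreal q') g S)
            \<le> ennreal (\<kappa> * \<kappa> * (real (card (UNIV :: ('n \<Rightarrow> bool) set)) * Bd))"
          using \<kappa> by (simp add: ennreal_leI mult_left_mono)
      qed
      finally show ?thesis .
    qed
    then show "sparse_form \<S> (ennreal p) (ennreal (q / (q - 1))) f g
        \<le> ennreal (\<kappa> * \<kappa> * (real (card (UNIV :: ('n \<Rightarrow> bool) set)) * H) 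
             * enn2real (A_const b (r / p) \<omega> * RH_const b (conj_exp (q / r)) \<omega>)
             powr max (1 / (r - p)) ((q - 1) / (q - r)) * A powr (1 / r) * B powr ((r - 1) / r))"
      unfolding q'_def Y_def[symmetric] Bd_def by (simp only: mult.assoc)
  qed
qed

section \<open>Duality\<close>

text \<open>For the extremal test function, the pairing with \<open>u\<close> and the r'-th power of
  its dual norm are the same number B. The hypothesis then reads B \<le> P B^(1-1/r), and dividing,
  which is possible as B is finite, gives B \<le> P^r. Nothing is presupposed about the norm of
  \<open>u\<close>.\<close>

lemma nn_integral_le_of_test_functions:
  fixes u \<omega> :: "real ^ 'n::finite \<Rightarrow> real" and r P :: real
  assumes r: "1 < r" and P: "0 \<le> P"
    and um: "u \<in> borel_measurable lebesgue" and \<omega>m: "\<omega> \<in> borel_measurable lebesgue" and \<omega>0: "\<And>x. 0 < \<omega> x"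
    and test: "\<And>g B. bounded_cpt_supp g \<Longrightarrow> 0 \<le> B \<Longrightarrow>
       (\<integral>\<^sup>+x. ennreal (norm (g x) powr (r / (r - 1)) * \<omega> x powr (- 1 / (r - 1))) \<partial>lebesgue) = ennreal B \<Longrightarrow>
       norm (LINT x|lebesgue. complex_of_real (u x) * g x) \<le> P * B powr ((r - 1) / r)"
  shows "(\<integral>\<^sup>+x. ennreal (\<bar>u x\<bar> powr r * \<omega> x) \<partial>lebesgue) \<le> ennreal (P powr r)"
proof -
  note [measurable] = um \<omega>m
  \<comment> \<open>The three restrictions make the test function bounded with bounded support and
    its dual norm finite, and these sets exhaust the space.\<close>
  define X where "X N = cball 0 (real N) \<inter> {x. \<bar>u x\<bar> \<le> real N \<and> \<omega> x \<le> real N}" for N :: nat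
  have Xm[measurable]: "X N \<in> sets lebesgue" for N
  proof -
    have "{x \<in> space lebesgue. \<bar>u x\<bar> \<le> real N \<and> \<omega> x \<le> real N} \<in> sets lebesgue" by measurable
    moreover have "cball (0 :: real ^ 'n) (real N) \<in> sets lebesgue" by simp
    ultimately show ?thesis unfolding X_def by (intro sets.Int) auto
  qed
  define h where "h N x = \<bar>u x\<bar> powr r * \<omega> x * indicator (X N) x" for N x
  have h0: "0 \<le> h N x" for N x using \<omega>0[of x] by (simp add: h_def)
  have hm[measurable]: "h N \<in> borel_measurable lebesgue" for N unfolding h_def by measurable
  have bound: "(\<integral>\<^sup>+x. ennreal (h N x) \<partial>lebesgue) \<le> ennreal (P powr r)" for N
  proof -
    have ball: "emeasure lebesgue (cball (0 :: real ^ 'n) (real N)) < \<infinity>"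
      using lmeasurable_compact[OF compact_cball, of "0 :: real ^ 'n" "real N"] by (simp add: fmeasurable_def)
    have "(\<integral>\<^sup>+x. ennreal (h N x) \<partial>lebesgue)
       \<le> (\<integral>\<^sup>+x. ennreal (real N powr r * real N) * indicator (cball (0 :: real ^ 'n) (real N)) x \<partial>lebesgue)"
    proof (rule nn_integral_mono)
      fix x :: "real ^ 'n"
      show "ennreal (h N x) \<le> ennreal (real N powr r * real N) * indicator (cball 0 (real N)) x"
      proof (cases "x \<in> X N")
        case True
        then have "h N x \<le> real N powr r * real N"
          using r \<omega>0[of x] by (auto simp: h_def X_def intro!: mult_mono powr_mono2)
        then show ?thesis using True by (simp add: X_def ennreal_leI)
      qed (simp add: h_def)
    qed
    also have "\<dots> = ennreal (real N powr r * real N) * emeasure lebesgue (cball (0 :: real ^ 'n) (real N))"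
      by (rule nn_integral_cmult_indicator) simp
    also have "\<dots> < \<infinity>" using ball by (simp add: ennreal_mult_less_top)
    finally obtain B where B: "(\<integral>\<^sup>+x. ennreal (h N x) \<partial>lebesgue) = ennreal B" "0 \<le> B"
      by (cases "\<integral>\<^sup>+x. ennreal (h N x) \<partial>lebesgue") auto
    define k where "k x = sgn (u x) * \<bar>u x\<bar> powr (r - 1) * \<omega> x * indicator (X N) x" for x
    have km: "k \<in> borel_measurable lebesgue" unfolding k_def by measurable
    define R where "R = real N powr (r - 1) * real N"
    have kR: "\<bar>k x\<bar> \<le> R" for x
    proof (cases "x \<in> X N")
      case True
      then have "\<bar>u x\<bar> powr (r - 1) * \<omega> x \<le> R"
        unfolding R_def using r \<omega>0[of x] by (auto simp: X_def intro!: mult_mono powr_mono2)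
      then show ?thesis using True \<omega>0[of x] by (simp add: k_def abs_mult abs_sgn_eq R_def)
    qed (simp add: k_def R_def)
    \<comment> \<open>Test functions must be Borel, but \<open>k\<close> is only Lebesgue
      measurable. A Borel version may violate size and support on a null set, so \<open>g\<close>
      cuts it off once more; where \<open>k = k'\<close> the cut changes nothing.\<close>
    obtain k' where k'm[measurable]: "k' \<in> borel_measurable lborel" and kk': "AE x in lborel. k x = k' x"
      using completion_ex_borel_measurable_real[OF km] by blast
    have [measurable]: "k' \<in> borel_measurable borel" using k'm by simp
    define g where "g x = complex_of_real (if norm x \<le> real N \<and> \<bar>k' x\<bar> \<le> R then k' x else 0)" for x
    have gk: "AE x in lebesgue. g x = complex_of_real (k x)"
    proof -
      have "AE x in lebesgue. k x = k' x" using kk' by (rule AE_completion)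
      then show ?thesis
      proof eventually_elim
        case (elim x)
        then show ?case using kR[of x] by (auto simp: g_def k_def X_def split: split_indicator)
      qed
    qed
    have g: "bounded_cpt_supp g"
      unfolding bounded_cpt_supp_def
    proof (intro conjI)
      show "g \<in> borel_measurable borel" unfolding g_def by measurable
      have "0 \<le> R" by (simp add: R_def)
      then show "bounded (range g)" by (intro boundedI[of _ R]) (auto simp: g_def)
      have "bounded {x. g x \<noteq> 0}"
        by (rule bounded_subset[OF bounded_cball[of 0 "real N"]]) (auto simp: g_def split: if_splits)
      then show "compact (closure {x. g x \<noteq> 0})" by simp
    qed
    have "(\<integral>\<^sup>+x. ennreal (norm (g x) powr (r / (r - 1)) * \<omega> x powr (- 1 / (r - 1))) \<partial>lebesgue)
      = (\<integral>\<^sup>+x. ennreal (h N x) \<partial>lebesgue)"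
    proof (rule nn_integral_cong_AE)
      show "AE x in lebesgue. ennreal (norm (g x) powr (r / (r - 1)) * \<omega> x powr (- 1 / (r - 1))) = ennreal (h N x)"
        using gk
      proof eventually_elim
        case (elim x)
        have "\<bar>k x\<bar> powr (r / (r - 1)) * \<omega> x powr (- 1 / (r - 1)) = h N x"
        proof (cases "x \<in> X N \<and> u x \<noteq> 0")
          case True
          have "\<bar>k x\<bar> powr (r / (r - 1)) = \<bar>u x\<bar> powr ((r - 1) * (r / (r - 1))) * \<omega> x powr (r / (r - 1))"
            using True \<omega>0[of x] by (simp add: k_def abs_mult abs_sgn_eq powr_mult powr_powr)
          moreover have "\<omega> x powr (r / (r - 1)) * \<omega> x powr (- 1 / (r - 1)) = \<omega> x powr (r / (r - 1) + - 1 / (r - 1))"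
            by (rule powr_add[symmetric])
          moreover have "r / (r - 1) + - 1 / (r - 1) = 1" "(r - 1) * (r / (r - 1)) = r"
            using r unfolding add_divide_distrib[symmetric] by auto
          ultimately show ?thesis using True \<omega>0[of x] by (simp add: h_def)
        qed (auto simp: k_def h_def)
        then show ?case using elim by simp
      qed
    qed
    then have testB: "norm (LINT x|lebesgue. complex_of_real (u x) * g x) \<le> P * B powr ((r - 1) / r)"
      using B by (intro test[OF g]) auto
    have "(LINT x|lebesgue. complex_of_real (u x) * g x) = (LINT x|lebesgue. complex_of_real (h N x))"
    proof (rule integral_cong_AE)
      show "(\<lambda>x. complex_of_real (u x) * g x) \<in> borel_measurable lebesgue"
      proof -
        have "g \<in> borel_measurable lborel" using g by (simp add: bounded_cpt_supp_def)
        then have [measurable]: "g \<in> borel_measurable lebesgue" by (rule measurable_completion)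
        show ?thesis by measurable
      qed
      show "AE x in lebesgue. complex_of_real (u x) * g x = complex_of_real (h N x)"
        using gk
      proof eventually_elim
        case (elim x)
        have "u x * k x = h N x"
        proof (cases "u x = 0")
          case False
          have "u x * k x = (\<bar>u x\<bar> powr 1 * \<bar>u x\<bar> powr (r - 1)) * \<omega> x * indicator (X N) x"
          proof -
            have "u x * k x = (u x * sgn (u x)) * \<bar>u x\<bar> powr (r - 1) * \<omega> x * indicator (X N) x"
              by (simp only: k_def mult.assoc)
            then show ?thesis by (simp flip: abs_sgn)
          qed
          then show ?thesis unfolding powr_add[symmetric] by (simp add: h_def)
        qed (simp add: h_def)
        then show ?case unfolding elim of_real_mult[symmetric] by simp
      qed
    qed measurable
    also have "\<dots> = complex_of_real (LINT x|lebesgue. h N x)" by (rule integral_complex_of_real)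
    also have "(LINT x|lebesgue. h N x) = B"
      using B h0 by (intro integral_eq_nn_integral[THEN trans]) auto
    finally have "B \<le> P * B powr ((r - 1) / r)" using testB B(2) by simp
    have "B \<le> P powr r"
    proof (cases "B = 0")
      case False
      then have "0 < B" using B by simp
      have "1 / r + (r - 1) / r = 1" using r unfolding add_divide_distrib[symmetric] by simp
      then have "B powr (1 / r) * B powr ((r - 1) / r) = B"
        using \<open>0 < B\<close> by (simp flip: powr_add)
      also note \<open>B \<le> P * B powr ((r - 1) / r)\<close>
      finally have "B powr (1 / r) * B powr ((r - 1) / r) \<le> P * B powr ((r - 1) / r)" .
      then have "B powr (1 / r) \<le> P" using \<open>0 < B\<close> by simp
      then have "(B powr (1 / r)) powr r \<le> P powr r" using r by (intro powr_mono2) auto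
      then show ?thesis using \<open>0 < B\<close> r by (simp add: powr_powr)
    qed simp
    then show ?thesis unfolding B(1) by (rule ennreal_leI)
  qed
  have "incseq (\<lambda>N x. ennreal (h N x))"
  proof (intro incseq_SucI le_funI ennreal_leI)
    fix N x
    have "X N \<subseteq> X (Suc N)" by (auto simp: X_def)
    then show "h N x \<le> h (Suc N) x"
      using \<omega>0[of x] by (auto simp: h_def split: split_indicator)
  qed
  moreover have "(SUP N. ennreal (h N x)) = ennreal (\<bar>u x\<bar> powr r * \<omega> x)" for x
  proof (rule antisym)
    show "(SUP N. ennreal (h N x)) \<le> ennreal (\<bar>u x\<bar> powr r * \<omega> x)"
      using \<omega>0[of x] by (intro SUP_least ennreal_leI) (auto simp: h_def split: split_indicator)
    obtain N :: nat where "max (norm x) (max \<bar>u x\<bar> (\<omega> x)) \<le> real N" using real_arch_simple by blast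
    then have "x \<in> X N" by (auto simp: X_def)
    then have "ennreal (\<bar>u x\<bar> powr r * \<omega> x) = ennreal (h N x)" by (simp add: h_def)
    also have "\<dots> \<le> (SUP N. ennreal (h N x))" by (rule SUP_upper) simp
    finally show "ennreal (\<bar>u x\<bar> powr r * \<omega> x) \<le> (SUP N. ennreal (h N x))" .
  qed
  ultimately have "(\<integral>\<^sup>+x. ennreal (\<bar>u x\<bar> powr r * \<omega> x) \<partial>lebesgue) = (SUP N. \<integral>\<^sup>+x. ennreal (h N x) \<partial>lebesgue)"
    using nn_integral_monotone_convergence_SUP[of "\<lambda>N x. ennreal (h N x)" lebesgue] by simp
  also have "\<dots> \<le> ennreal (P powr r)" by (rule SUP_least[OF bound])
  finally show ?thesis .
qed

text \<open>For a supremum over uncountably many parameters measurability is not evident. It is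
  extracted from the integrability of the pairing with indicators of balls: at each point the
  localised functions agree with \<open>T f\<close> from some radius on.\<close>

lemma sparse_bound_measurable:
  assumes T: "sparse_bound b T p s" and f: "bounded_cpt_supp f"
  shows "T f \<in> borel_measurable lebesgue"
proof -
  define c :: "nat \<Rightarrow> real ^ 'a \<Rightarrow> complex" where "c N = indicator (cball 0 (real N))" for N
  have c: "bounded_cpt_supp (c N)" for N
    unfolding bounded_cpt_supp_def
  proof (intro conjI)
    show "c N \<in> borel_measurable borel" unfolding c_def by (rule borel_measurable_indicator) simp
    show "bounded (range (c N))" by (rule boundedI[of _ 1]) (auto simp: c_def indicator_def)
    have "{x. c N x \<noteq> 0} = cball 0 (real N)" by (auto simp: c_def indicator_def)
    then show "compact (closure {x. c N x \<noteq> 0})" by simp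
  qed
  have m: "(\<lambda>x. Re (complex_of_real (T f x) * c N x)) \<in> borel_measurable lebesgue" for N
  proof -
    have "integrable lebesgue (\<lambda>x. complex_of_real (T f x) * c N x)"
      using T f c[of N] unfolding sparse_bound_def by blast
    then have [measurable]: "(\<lambda>x. complex_of_real (T f x) * c N x) \<in> borel_measurable lebesgue"
      by (rule borel_measurable_integrable)
    show ?thesis by measurable
  qed
  show ?thesis
  proof (rule borel_measurable_LIMSEQ_real[OF _ m])
    fix x
    have "\<forall>\<^sub>F N in sequentially. Re (complex_of_real (T f x) * c N x) = T f x"
    proof -
      obtain M :: nat where "norm x \<le> real M" using real_arch_simple by blast
      then have "Re (complex_of_real (T f x) * c N x) = T f x" if "M \<le> N" for N
        using that by (simp add: c_def indicator_def)
      then show ?thesis by (auto simp: eventually_sequentially)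
    qed
    then show "(\<lambda>N. Re (complex_of_real (T f x) * c N x)) \<longlonglongrightarrow> T f x" by (rule tendsto_eventually)
  qed
qed

lemma sparse_bound_imp_weighted_bound:
  fixes b :: "'n::finite \<Rightarrow> real" and p q r :: real
  assumes b: "\<And>j. b j \<ge> 1" and pqr: "1 \<le> p" "p < r" "r < q"
    and T: "sparse_bound b T (ennreal p) (ennreal (q / (q - 1)))"
  shows "\<exists>K::real. \<forall>\<omega> \<in> A_class b (r / p) \<inter> RH_class b (conj_exp (q / r)).
           \<forall>f. bounded_cpt_supp f \<longrightarrow>
             wnorm r \<omega> (T f)
               \<le> ennreal K
                 * epowr (A_const b (r / p) \<omega> * RH_const b (conj_exp (q / r)) \<omega>)
                     (max (1 / (r - p)) ((q - 1) / (q - r)))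
                 * wnorm r \<omega> f"
proof -
  obtain C0 where C0: "\<And>f g. bounded_cpt_supp f \<Longrightarrow> bounded_cpt_supp g \<Longrightarrow>
      ennreal (norm (LINT x|lebesgue. complex_of_real (T f x) * g x))
          \<le> ennreal C0 * (SUP \<S>\<in>{\<S>. sparse b \<S>}. sparse_form \<S> (ennreal p) (ennreal (q / (q - 1))) f g)"
    using T unfolding sparse_bound_def by blast
  \<comment> \<open>A negative \<open>C0\<close> acts as 0 in the extended reals, so the maximum
    keeps the bound and makes the constant usable in real arithmetic.\<close>
  define C where "C = max C0 0"
  obtain K where K: "0 \<le> K"
    "\<And>\<omega> f g \<S> A B. \<omega> \<in> A_class b (r / p) \<Longrightarrow> \<omega> \<in> RH_class b (conj_exp (q / r)) \<Longrightarrow>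
      bounded_cpt_supp f \<Longrightarrow> bounded_cpt_supp g \<Longrightarrow> sparse b \<S> \<Longrightarrow> 0 \<le> A \<Longrightarrow> 0 \<le> B \<Longrightarrow>
      (\<integral>\<^sup>+x. ennreal (norm (f x) powr r * \<omega> x) \<partial>lebesgue) = ennreal A \<Longrightarrow>
      (\<integral>\<^sup>+x. ennreal (norm (g x) powr (r / (r - 1)) * \<omega> x powr (- 1 / (r - 1))) \<partial>lebesgue) = ennreal B \<Longrightarrow>
      sparse_form \<S> (ennreal p) (ennreal (q / (q - 1))) f g
        \<le> ennreal (K * enn2real (A_const b (r / p) \<omega> * RH_const b (conj_exp (q / r)) \<omega>)
             powr max (1 / (r - p)) ((q - 1) / (q - r)) * A powr (1 / r) * B powr ((r - 1) / r))"
    by (fact sparse_form_le[of b, OF b pqr])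
  define \<alpha> where "\<alpha> = max (1 / (r - p)) ((q - 1) / (q - r))"
  have r: "1 < r" using pqr by simp
  show ?thesis
    unfolding \<alpha>_def[symmetric]
  proof (intro exI[of _ "C * K"] ballI allI impI, elim IntE)
    fix \<omega> and f :: "real ^ 'n \<Rightarrow> complex"
    assume \<omega>: "\<omega> \<in> A_class b (r / p)" "\<omega> \<in> RH_class b (conj_exp (q / r))" and f: "bounded_cpt_supp f"
    define Y where "Y = enn2real (A_const b (r / p) \<omega> * RH_const b (conj_exp (q / r)) \<omega>)"
    have AR: "A_const b (r / p) \<omega> * RH_const b (conj_exp (q / r)) \<omega> < top"
      using \<omega> by (simp add: A_class_def RH_class_def ennreal_mult_less_top)
    have \<omega>m: "\<omega> \<in> borel_measurable lebesgue" and \<omega>0: "\<And>x. 0 < \<omega> x"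
      and \<omega>i: "\<And>K. compact K \<Longrightarrow> set_integrable lebesgue K \<omega>"
      using \<omega>(1) by (auto simp: A_class_def weight_def)
    have "(\<integral>\<^sup>+x. ennreal (norm (f x) powr r * \<omega> x) \<partial>lebesgue) < \<infinity>"
      using r \<omega>m \<omega>0 \<omega>i by (intro bounded_cpt_supp_powr(2)[OF f]) (auto simp: less_imp_le)
    then obtain A where A: "(\<integral>\<^sup>+x. ennreal (norm (f x) powr r * \<omega> x) \<partial>lebesgue) = ennreal A" "0 \<le> A"
      by (cases "\<integral>\<^sup>+x. ennreal (norm (f x) powr r * \<omega> x) \<partial>lebesgue") auto
    define P where "P = C * (K * Y powr \<alpha> * A powr (1 / r))"
    have P: "0 \<le> P" using K(1) by (simp add: P_def C_def)
    have "(\<integral>\<^sup>+x. ennreal (\<bar>T f x\<bar> powr r * \<omega> x) \<partial>lebesgue) \<le> ennreal (P powr r)"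
    proof (rule nn_integral_le_of_test_functions[OF r P sparse_bound_measurable[OF T f] \<omega>m \<omega>0])
      fix g B
      assume g: "bounded_cpt_supp g" and B: "0 \<le> B"
        "(\<integral>\<^sup>+x. ennreal (norm (g x) powr (r / (r - 1)) * \<omega> x powr (- 1 / (r - 1))) \<partial>lebesgue) = ennreal B"
      have "(SUP \<S>\<in>{\<S>. sparse b \<S>}. sparse_form \<S> (ennreal p) (ennreal (q / (q - 1))) f g)
          \<le> ennreal (K * Y powr \<alpha> * A powr (1 / r) * B powr ((r - 1) / r))"
        unfolding Y_def \<alpha>_def by (rule SUP_least) (use K(2)[OF \<omega> f g _ A(2) B(1) A(1) B(2)] in auto)
      then have "ennreal (norm (LINT x|lebesgue. complex_of_real (T f x) * g x))
         \<le> ennreal C * ennreal (K * Y powr \<alpha> * A powr (1 / r) * B powr ((r - 1) / r))"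
        by (intro order_trans[OF C0[OF f g]] mult_mono) (auto simp: C_def ennreal_leI)
      also have "\<dots> = ennreal (P * B powr ((r - 1) / r))"
        unfolding P_def by (subst ennreal_mult'[symmetric]) (auto simp: C_def mult_ac)
      finally show "norm (LINT x|lebesgue. complex_of_real (T f x) * g x) \<le> P * B powr ((r - 1) / r)"
        using P by (subst (asm) ennreal_le_iff) auto
    qed
    then obtain D where D: "(\<integral>\<^sup>+x. ennreal (\<bar>T f x\<bar> powr r * \<omega> x) \<partial>lebesgue) = ennreal D" "0 \<le> D" "D \<le> P powr r"
      by (cases "\<integral>\<^sup>+x. ennreal (\<bar>T f x\<bar> powr r * \<omega> x) \<partial>lebesgue") (auto simp: top_unique)
    have "D powr (1 / r) \<le> (P powr r) powr (1 / r)" using D r by (intro powr_mono2) auto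
    also have "\<dots> = P" using r P by (simp add: powr_powr)
    finally have "wnorm r \<omega> (T f) \<le> ennreal P"
      using D by (simp add: wnorm_def epowr_def ennreal_leI)
    also have "ennreal P = ennreal (C * K) * ennreal (Y powr \<alpha>) * ennreal (A powr (1 / r))"
    proof -
      have "P = C * K * Y powr \<alpha> * A powr (1 / r)" by (simp only: P_def mult.assoc)
      moreover have "0 \<le> C * K" using K(1) by (simp add: C_def)
      ultimately show ?thesis by (simp only: ennreal_mult ennreal_mult' mult_nonneg_nonneg powr_ge_zero)
    qed
    also have "ennreal (Y powr \<alpha>) = epowr (A_const b (r / p) \<omega> * RH_const b (conj_exp (q / r)) \<omega>) \<alpha>"
      using AR by (simp add: epowr_def Y_def)
    also have "ennreal (A powr (1 / r)) = wnorm r \<omega> f"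
      using A by (simp add: wnorm_def epowr_def)
    finally show "wnorm r \<omega> (T f) \<le> ennreal (C * K) 
        * epowr (A_const b (r / p) \<omega> * RH_const b (conj_exp (q / r)) \<omega>) \<alpha> * wnorm r \<omega> f" .
  qed
qed

lemma enn2real_one_divide_ennreal:
  "0 < x \<Longrightarrow> enn2real (1 / ennreal x) = 1 / x"
  by (subst ennreal_1[symmetric], subst divide_ennreal) auto

theorem corollary1p19:
  fixes \<Omega> U :: "(real ^ 'k::finite) set"
    and \<Phi> :: "'n::finite \<Rightarrow> real ^ 'k \<Rightarrow> real"
    and \<eta> :: "real ^ 'k \<Rightarrow> real"
    and b :: "'n \<Rightarrow> real"
    and L :: "(real \<times> real) set"
    and p q r :: real
  assumes "CARD('k) \<le> CARD('n)"
    and "open \<Omega>" and "0 \<in> \<Omega>"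
    and "\<And>j. smooth_on \<Omega> (\<Phi> j)"
    and "open U" and "bounded U" and "0 \<in> U" and "U \<subseteq> \<Omega>"
    and "smooth_on UNIV \<eta>" and "closure {x. \<eta> x \<noteq> 0} \<subseteq> U"
    and "\<And>j. b j \<ge> 1"
    and "L \<subseteq> {0..1} \<times> {0..1}" and "convex L" and "polytope (closure L)" and "interior L \<noteq> {}"
    and sparse_bounds: "\<And>p0 s0 :: ennreal. 1 \<le> p0 \<Longrightarrow> 1 \<le> s0 \<Longrightarrow>
          (enn2real (1 / p0), enn2real (1 / s0)) \<in> dual_region L \<Longrightarrow>
          sparse_bound b (max_op b \<Phi> \<eta>) p0 s0"
    and "1 \<le> p" and "p < r" and "r < q"
    and "(1 / p, 1 / q) \<in> L"
  shows "\<exists>K::real. \<forall>\<omega> \<in> A_class b (r / p) \<inter> RH_class b (conj_exp (q / r)).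
           \<forall>f. bounded_cpt_supp f \<longrightarrow>
             wnorm r \<omega> (max_op b \<Phi> \<eta> f)
               \<le> ennreal K
                 * epowr (A_const b (r / p) \<omega> * RH_const b (conj_exp (q / r)) \<omega>)
                     (max (1 / (r - p)) ((q - 1) / (q - r)))
                 * wnorm r \<omega> f"
proof (rule sparse_bound_imp_weighted_bound)
  have q: "1 < q" using \<open>1 \<le> p\<close> \<open>p < r\<close> \<open>r < q\<close> by simp
  show "sparse_bound b (max_op b \<Phi> \<eta>) (ennreal p) (ennreal (q / (q - 1)))"
  proof (rule sparse_bounds)
    show "1 \<le> ennreal p" using \<open>1 \<le> p\<close> by simp
    show "1 \<le> ennreal (q / (q - 1))" using q by simp
    \<comment> \<open>\<open>q / (q - 1)\<close> is q', so the reflection in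
      \<open>dual_region\<close> leads back to the point (1/p, 1/q) of \<open>L\<close>.\<close>
    have "1 - 1 / (q / (q - 1)) = 1 / q" using q by (simp add: field_simps)
    then show "(enn2real (1 / ennreal p), enn2real (1 / ennreal (q / (q - 1)))) \<in> dual_region L"
      using \<open>(1 / p, 1 / q) \<in> L\<close> \<open>1 \<le> p\<close> q by (simp add: dual_region_def enn2real_one_divide_ennreal)
  qed
qed fact+

end
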